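(* Let $(q_k)_{k\ge 1}$ be a sequence of positive integers with $q_{k+1}\ge q_k(q_k+1)$ for all $k\ge 1$, let $(\xi_k)_{k\ge1}$ be independent random variables with $\mathsf{P}\{\xi_k=0\}=p_{0k}$, $\mathsf{P}\{\xi_k=1\}=p_{1k}$, $p_{0k}+p_{1k}=1$, and let $\mu$ be the distribution and $F_\xi$ the distribution function of $$\xi=\sum_{k=1}^\infty \frac{(-1)^{k+1}\xi_k}{q_k}.$$ Let $S_\mu$ be the spectrum of $\mu$ and $\nu^*$ the uniform distribution on $S_\mu$ (as defined in the context). Suppose there exists a constant $p_0>0$ such that $p_{ik}>p_0$ for all $i\in\{0,1\}$ and $k\in\mathbb{N}$. Then $F_\xi$ preserves the Hausdorff–Billingsley dimension on the spectrum $S_\mu$, i.e. $$\dim_H(E,\mu)=\dim_H(E,\nu^* )\quad\text{for every }E\subseteq S_\mu,$$ if and only if the Hausdorff–Billingsley dimension $\dim_H(\mu,\nu^* )$ of $\mu$ with respect to $\nu^*$ equals $1$, i.e. if and only if $$\liminf_{n\to\infty}\frac{H_n}{g_n\ln2}=1,$$ where $h_n=-(p_{0n}\ln p_{0n}+p_{1n}\ln p_{1n})$, $H_n=h_1+\dots+h_n$, and $g_n$ is the number of positive elements among $h_1,\dots,h_n$.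
   Context: The spectrum $S_\mu$ of $\mu$ is its minimal closed support. The measure $\nu^*$ is the distribution of the random variable $\xi^*=\sum_{k=1}^\infty\frac{(-1)^{k+1}\xi^*_k}{q_k}$, where $\xi^*_k$ are independent random variables taking the values $0$ and $1$ with probabilities $p^*_{0k}$ and $p^*_{1k}$ such that, for $i\in\{0,1\}$: $p^*_{ik}=0$ iff $p_{ik}=0$; $p^*_{ik}=1$ iff $p_{ik}=1$; $p^*_{ik}=\frac12$ iff $p_{ik}\in(0,1)$. For a continuous (atomless) probability measure $\nu$ on $\mathbb{R}$, a bounded set $E\subset\mathbb{R}$ and $\alpha>0$, put $$H^\alpha(E,\nu)=\lim_{\varepsilon\to0}\ \inf\Big\{\sum_j(\nu(E_j))^\alpha\Big\},$$ where the infimum is over all at most countable coverings $\{E_j\}$ of $E$ by closed intervals with $\nu(E_j)\le\varepsilon$ (one may restrict to subintervals of a fixed bounded closed interval containing $E$). The Hausdorff–Billingsley dimension of $E$ with respect to $\nu$ is $\dim_H(E,\nu)=\inf\{\alpha>0: H^\alpha(E,\nu)=0\}$. The Hausdorff–Billingsley dimension of a probability measure $\mu$ (with bounded support) with respect to $\nu$ is $\dim_H(\mu,\nu)=\inf\{\dim_H(E,\nu): E \text{ a bounded Borel set},\ \mu(E)=1\}$. *)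

theory Defs
  imports "HOL-Probability.Probability"
begin

definition spectrum :: "'a::topological_space measure \<Rightarrow> 'a set" where
  "spectrum \<mu> = \<Inter>{C. closed C \<and> emeasure \<mu> (- C) = 0}"

text \<open>The intersection is itself a closed set of full measure, hence the least one.\<close>

lemma closed_spectrum: "closed (spectrum \<mu>)"
  unfolding spectrum_def by (rule closed_Inter) auto

lemma emeasure_compl_spectrum:
  fixes \<mu> :: "'a::second_countable_topology measure"
  assumes "sets \<mu> = sets borel"
  shows "emeasure \<mu> (- spectrum \<mu>) = 0"
proof -
  let ?U = "{U. open U \<and> emeasure \<mu> U = 0}"
  have eq: "- spectrum \<mu> = \<Union>?U"
  proof -
    have "{C. closed C \<and> emeasure \<mu> (- C) = 0} = uminus ` ?U"
    proof (intro equalityI subsetI)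
      fix C assume "C \<in> {C. closed C \<and> emeasure \<mu> (- C) = 0}"
      then have "- C \<in> ?U" by (simp add: closed_def)
      then show "C \<in> uminus ` ?U" by (rule rev_image_eqI) simp
    next
      fix C assume "C \<in> uminus ` ?U"
      then show "C \<in> {C. closed C \<and> emeasure \<mu> (- C) = 0}" by auto
    qed
    then show ?thesis
      unfolding spectrum_def by auto
  qed
  obtain V where V: "V \<subseteq> ?U" "countable V" "\<Union>V = \<Union>?U"
    using Lindelof[of ?U] by blast
  have "V \<subseteq> null_sets \<mu>"
    using V(1) assms by (auto simp: null_sets_def)
  then have "(\<Union>U\<in>V. U) \<in> null_sets \<mu>"
    using V(2) by (intro null_sets_UN') auto
  then show ?thesis
    using V(3) eq by auto
qed

definition independent_digits ::
    "'a measure \<Rightarrow> (nat \<Rightarrow> 'a \<Rightarrow> real) \<Rightarrow> (nat \<Rightarrow> nat \<Rightarrow> real) \<Rightarrow> bool" where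
  "independent_digits M X p \<longleftrightarrow>
     prob_space.indep_vars M (\<lambda>_. borel) X {1..} \<and>
     (\<forall>k\<ge>1. \<forall>i\<in>{0,1}. measure M {\<omega>\<in>space M. X k \<omega> = real i} = p i k)"

text \<open>
  The series runs over \<open>k \<ge> 1\<close>; it is written with \<open>Suc k\<close>, so that the sign
  \<open>(-1) ^ (Suc k + 1)\<close> is \<open>(-1) ^ k\<close>.
\<close>

definition alt_series :: "(nat \<Rightarrow> nat) \<Rightarrow> (nat \<Rightarrow> 'a \<Rightarrow> real) \<Rightarrow> 'a \<Rightarrow> real" where
  "alt_series q X \<omega> = (\<Sum>k. (-1) ^ k * X (Suc k) \<omega> / real (q (Suc k)))"

definition p_star :: "(nat \<Rightarrow> nat \<Rightarrow> real) \<Rightarrow> nat \<Rightarrow> nat \<Rightarrow> real" where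
  "p_star p i k = (if p i k = 0 then 0 else if p i k = 1 then 1 else 1 / 2)"

text \<open>
  Countable coverings by closed intervals are sequences \<open>{a n..b n}\<close>. Intervals with
  \<open>a n > b n\<close> are empty and contribute \<open>0\<close> to the sum, so finite coverings are included.
\<close>

definition HB_premeasure :: "real measure \<Rightarrow> real \<Rightarrow> real \<Rightarrow> real set \<Rightarrow> ennreal" where
  "HB_premeasure \<nu> \<alpha> \<epsilon> E =
     (INF (a, b)\<in>{(a, b). E \<subseteq> (\<Union>n::nat. {a n..b n}) \<and> (\<forall>n. measure \<nu> {a n..b n} \<le> \<epsilon>)}.
        \<Sum>n. ennreal (measure \<nu> {a n..b n} powr \<alpha>))"

definition HB_measure :: "real measure \<Rightarrow> real \<Rightarrow> real set \<Rightarrow> ennreal" where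
  "HB_measure \<nu> \<alpha> E = Lim (at_right 0) (\<lambda>\<epsilon>. HB_premeasure \<nu> \<alpha> \<epsilon> E)"

text \<open>The limit always exists, since the infimum is antimonotone in \<open>\<epsilon>\<close>.\<close>

lemma HB_premeasure_antimono:
  assumes "\<delta> \<le> \<epsilon>"
  shows "HB_premeasure \<nu> \<alpha> \<epsilon> E \<le> HB_premeasure \<nu> \<alpha> \<delta> E"
proof -
  have "{(a, b). E \<subseteq> (\<Union>n::nat. {a n..b n}) \<and> (\<forall>n. measure \<nu> {a n..b n} \<le> \<delta>)}
      \<subseteq> {(a, b). E \<subseteq> (\<Union>n::nat. {a n..b n}) \<and> (\<forall>n. measure \<nu> {a n..b n} \<le> \<epsilon>)}"
    using order_trans[OF _ assms] by blast
  then show ?thesis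
    unfolding HB_premeasure_def by (rule INF_superset_mono) simp
qed

lemma HB_premeasure_tendsto:
  "((\<lambda>\<epsilon>. HB_premeasure \<nu> \<alpha> \<epsilon> E) \<longlongrightarrow> (SUP \<epsilon>\<in>{0<..}. HB_premeasure \<nu> \<alpha> \<epsilon> E)) (at_right 0)"
proof (rule order_tendstoI)
  fix y assume "y < (SUP \<epsilon>\<in>{0<..}. HB_premeasure \<nu> \<alpha> \<epsilon> E)"
  then obtain d where d: "d > 0" "y < HB_premeasure \<nu> \<alpha> d E"
    by (auto simp: less_SUP_iff)
  have "eventually (\<lambda>\<epsilon>. \<epsilon> \<in> {0<..<d}) (at_right (0::real))"
    using d(1) by (rule eventually_at_right_real)
  then show "eventually (\<lambda>\<epsilon>. y < HB_premeasure \<nu> \<alpha> \<epsilon> E) (at_right 0)"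
  proof eventually_elim
    fix \<epsilon> assume "\<epsilon> \<in> {0<..<d}"
    then have "HB_premeasure \<nu> \<alpha> d E \<le> HB_premeasure \<nu> \<alpha> \<epsilon> E"
      by (intro HB_premeasure_antimono) simp
    with d(2) show "y < HB_premeasure \<nu> \<alpha> \<epsilon> E" by (rule less_le_trans)
  qed
next
  fix y assume y: "(SUP \<epsilon>\<in>{0<..}. HB_premeasure \<nu> \<alpha> \<epsilon> E) < y"
  have "eventually (\<lambda>\<epsilon>. \<epsilon> > 0) (at_right (0::real))"
    by (rule eventually_at_right_less)
  then show "eventually (\<lambda>\<epsilon>. HB_premeasure \<nu> \<alpha> \<epsilon> E < y) (at_right 0)"
  proof eventually_elim
    fix \<epsilon> :: real assume "\<epsilon> > 0"
    then have "HB_premeasure \<nu> \<alpha> \<epsilon> E \<le> (SUP \<epsilon>\<in>{0<..}. HB_premeasure \<nu> \<alpha> \<epsilon> E)"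
      by (intro SUP_upper) simp
    then show "HB_premeasure \<nu> \<alpha> \<epsilon> E < y" using y by (rule le_less_trans)
  qed
qed

lemma HB_measure_eq_SUP:
  "HB_measure \<nu> \<alpha> E = (SUP \<epsilon>\<in>{0<..}. HB_premeasure \<nu> \<alpha> \<epsilon> E)"
  unfolding HB_measure_def
  by (rule tendsto_Lim[OF _ HB_premeasure_tendsto]) simp

definition HB_dim :: "real set \<Rightarrow> real measure \<Rightarrow> ereal" where
  "HB_dim E \<nu> = Inf {ereal \<alpha> |\<alpha>. \<alpha> > 0 \<and> HB_measure \<nu> \<alpha> E = 0}"

definition HB_dim_measure :: "real measure \<Rightarrow> real measure \<Rightarrow> ereal" where
  "HB_dim_measure \<mu> \<nu> =
     (INF E\<in>{E. E \<in> sets borel \<and> bounded E \<and> measure \<mu> E = 1}. HB_dim E \<nu>)"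

definition digit_entropy :: "(nat \<Rightarrow> nat \<Rightarrow> real) \<Rightarrow> nat \<Rightarrow> real" where
  "digit_entropy p n = - (p 0 n * ln (p 0 n) + p 1 n * ln (p 1 n))"

definition total_entropy :: "(nat \<Rightarrow> nat \<Rightarrow> real) \<Rightarrow> nat \<Rightarrow> real" where
  "total_entropy p n = (\<Sum>k=1..n. digit_entropy p k)"

definition num_positive_entropy :: "(nat \<Rightarrow> nat \<Rightarrow> real) \<Rightarrow> nat \<Rightarrow> nat" where
  "num_positive_entropy p n = card {k\<in>{1..n}. digit_entropy p k > 0}"

end

theory Submission
  imports Defs
begin

text \<open>
  Each coefficient \<open>(-1) ^ k / q\<^sub>k\<^sub>+\<^sub>1\<close> exceeds in absolute value the sum of all later
  ones, so a value of the series determines its digits. The values whose first \<open>n\<close> digits form a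
  given word lie in a cylinder interval, and the \<open>2 ^ n\<close> cylinder intervals of rank \<open>n\<close> are
  disjoint (\<open>cyl_separated\<close>). On a cylinder of rank \<open>n\<close> the measure \<open>\<mu>\<close>
  is the product of the digit probabilities and \<open>\<nu>\<close> is \<open>2 ^ (-n)\<close>. As all digit
  probabilities are bounded away from \<open>0\<close>, every digit has positive entropy, so the number of
  positive entropies among the first \<open>n\<close> is \<open>n\<close>, and the entropy ratio is at most \<open>1\<close>. The
  equivalences follow from a cycle of three implications.

  If the lower limit is \<open>1\<close>, then the ratio tends to \<open>1\<close>, so the average entropy deficit
  \<open>ln 2 - h\<^sub>k\<close> tends to \<open>0\<close>. The deficit controls the squared distance of the digit
  probabilities from \<open>1/2\<close>, hence the average of \<open>\<bar>ln (2 p\<^sub>i\<^sub>k)\<bar>\<close> tends to \<open>0\<close> too. So all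
  cylinders of rank \<open>n\<close> have \<open>\<mu>\<close>-measure \<open>2 ^ (- n (1 + o(1)))\<close>, uniformly
  (\<open>log_dyadic_digit_weight\<close>). An interval that is too light to contain a whole cylinder of rank
  \<open>n\<close> meets at most two of them. Therefore the two measures of any interval of small measure differ
  only by an exponent close to \<open>1\<close> (\<open>interval_measure_le_powr\<close>), and every covering serves
  both measures: the dimensions agree for all sets.

  If dimensions on the spectrum are preserved, a set \<open>E\<close> of full \<open>\<mu>\<close>-measure satisfies
  \<open>dim (E, \<nu>) \<ge> dim (E \<inter> S, \<nu>) = dim (E \<inter> S, \<mu>) \<ge> 1\<close>, because subadditivity of \<open>\<mu>\<close>
  bounds the covering sums for exponents up to \<open>1\<close> below by \<open>1\<close>. Conversely,
  covering by the cylinders of rank \<open>n\<close> shows that the dimension of \<open>\<mu>\<close> is at most \<open>1\<close>.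

  If the lower limit is less than \<open>r < 1\<close>, then for infinitely many \<open>n\<close> the total entropy is at
  most \<open>n r ln 2\<close>. By Chebyshev's inequality the logarithm of the measure of a \<open>\<mu>\<close>-random
  cylinder of such a rank is close to the negative of the total entropy, so up to small measure
  \<open>\<mu>\<close> lives on cylinders of measure at least \<open>2 ^ (- n d)\<close>, where \<open>r < d < 1\<close>. There are at
  most \<open>2 ^ (n d)\<close> of these. The set of points that lie in infinitely many of them has full
  \<open>\<mu>\<close>-measure and \<open>\<nu>\<close>-dimension at most \<open>d\<close> (\<open>HB_dim_measure_le_entropy\<close>).
\<close>

section \<open>Cylinder intervals of a series with dominating terms\<close>

locale dominating_series =
  fixes c :: "nat \<Rightarrow> real"
  assumes summable_abs: "summable (\<lambda>k. \<bar>c k\<bar>)"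
    and tail_less: "(\<Sum>j. \<bar>c (j + Suc k)\<bar>) < \<bar>c k\<bar>"
begin

definition subsum :: "nat set \<Rightarrow> real" where
  "subsum A = (\<Sum>k. c k * indicator A k)"

text \<open>
  A word of length \<open>n\<close> is encoded as the set \<open>B \<subseteq> {..<n}\<close> of positions with digit \<open>1\<close>. The
  series is extremal among the continuations of a word when it takes all later terms of one sign.
\<close>
definition left_end :: "nat \<Rightarrow> nat set \<Rightarrow> real" where
  "left_end n B = subsum (B \<union> {k. n \<le> k \<and> c k < 0})"

definition right_end :: "nat \<Rightarrow> nat set \<Rightarrow> real" where
  "right_end n B = subsum (B \<union> {k. n \<le> k \<and> c k > 0})"

definition cyl :: "nat \<Rightarrow> nat set \<Rightarrow> real set" where
  "cyl n B = {left_end n B..right_end n B}"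

lemma summable_subsum: "summable (\<lambda>k. c k * indicator A k)"
  by (rule summable_comparison_test'[OF summable_abs, of 0]) (simp add: abs_mult indicator_def)

text \<open>
  At the first position where two digit sequences differ, the term there outweighs everything that
  follows.
\<close>
lemma subsum_diff_near_term:
  assumes agree: "A \<inter> {..<k} = A' \<inter> {..<k}" and k: "k \<in> A" "k \<notin> A'"
  shows "\<bar>subsum A - subsum A' - c k\<bar> < \<bar>c k\<bar>"
proof -
  let ?d = "\<lambda>j. c j * indicator A j - c j * indicator A' j"
  have d0: "?d j = 0" if "j < k" for j
  proof -
    have "j \<in> A \<longleftrightarrow> j \<in> A'" using agree that by blast
    then show ?thesis by (simp add: indicator_def)
  qed
  have sd: "summable ?d"
    by (intro summable_diff summable_subsum)
  have "subsum A - subsum A' = (\<Sum>j. ?d j)"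
    unfolding subsum_def by (intro suminf_diff summable_subsum)
  also have "\<dots> = (\<Sum>j. ?d (j + Suc k)) + (\<Sum>j<Suc k. ?d j)"
    by (rule suminf_split_initial_segment[OF sd])
  also have "(\<Sum>j<Suc k. ?d j) = c k"
  proof -
    have "(\<Sum>j<k. ?d j) = 0" by (rule sum.neutral) (use d0 in blast)
    then show ?thesis using k by (simp only: sum.lessThan_Suc) simp
  qed
  finally have eq: "subsum A - subsum A' - c k = (\<Sum>j. ?d (j + Suc k))"
    by simp
  have le: "\<bar>?d j\<bar> \<le> \<bar>c j\<bar>" for j
    by (simp add: indicator_def)
  have s1: "summable (\<lambda>j. \<bar>c (j + Suc k)\<bar>)"
    using summable_abs by (subst summable_iff_shift)
  have s2: "summable (\<lambda>j. \<bar>?d (j + Suc k)\<bar>)"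
    by (rule summable_comparison_test'[OF s1, of 0]) (use le in auto)
  have "\<bar>\<Sum>j. ?d (j + Suc k)\<bar> \<le> (\<Sum>j. \<bar>?d (j + Suc k)\<bar>)"
    by (rule summable_rabs[OF s2])
  also have "\<dots> \<le> (\<Sum>j. \<bar>c (j + Suc k)\<bar>)"
    by (rule suminf_le[OF le s2 s1])
  also have "\<dots> < \<bar>c k\<bar>" by (rule tail_less)
  finally show ?thesis unfolding eq .
qed

lemma cyl_separated:
  assumes B: "B \<subseteq> {..<n}" and C: "C \<subseteq> {..<n}" and "B \<noteq> C"
  shows "right_end n B < left_end n C \<or> right_end n C < left_end n B"
proof -
  have main: "right_end n B < left_end n C \<or> right_end n C < left_end n B"
    if B: "B \<subseteq> {..<n}" and C: "C \<subseteq> {..<n}" and k: "k \<in> B" "k \<notin> C"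
      and agree: "B \<inter> {..<k} = C \<inter> {..<k}" for B C k
  proof -
    have kn: "k < n" using B k by auto
    have key: "\<bar>subsum (B \<union> S) - subsum (C \<union> T) - c k\<bar> < \<bar>c k\<bar>"
      if "S \<subseteq> {n..}" "T \<subseteq> {n..}" for S T
      by (rule subsum_diff_near_term) (use that kn k agree in auto)
    have "\<bar>left_end n B - right_end n C - c k\<bar> < \<bar>c k\<bar>"
      "\<bar>right_end n B - left_end n C - c k\<bar> < \<bar>c k\<bar>"
      unfolding left_end_def right_end_def by (rule key; auto)+
    then show ?thesis by linarith
  qed
  let ?P = "\<lambda>k. (k \<in> B) \<noteq> (k \<in> C)"
  define k where "k = (LEAST k. ?P k)"
  obtain j where "?P j" using \<open>B \<noteq> C\<close> by blast
  then have k: "?P k" unfolding k_def by (rule LeastI)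
  have agree: "B \<inter> {..<k} = C \<inter> {..<k}"
    using not_less_Least[of _ ?P] unfolding k_def by blast
  show ?thesis
  proof (cases "k \<in> B")
    case True
    then show ?thesis using main[OF B C _ _ agree] k by blast
  next
    case False
    then show ?thesis using main[OF C B _ _ agree[symmetric]] k by blast
  qed
qed

lemma cyl_disjoint:
  assumes "B \<subseteq> {..<n}" "C \<subseteq> {..<n}" "B \<noteq> C"
  shows "cyl n B \<inter> cyl n C = {}"
  using cyl_separated[OF assms] unfolding cyl_def by auto

lemma subsum_mono:
  assumes "\<And>k. c k * indicator A k \<le> c k * indicator A' k"
  shows "subsum A \<le> subsum A'"
  unfolding subsum_def by (intro suminf_le assms summable_subsum)

lemma subsum_in_cyl: "subsum A \<in> cyl n (A \<inter> {..<n})"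
  unfolding cyl_def left_end_def right_end_def
  by (auto intro!: subsum_mono simp: indicator_def)

lemma cyl_subset_cyl_0: "cyl n B \<subseteq> cyl 0 {}"
proof -
  have "left_end 0 {} \<le> left_end n B" "right_end n B \<le> right_end 0 {}"
    unfolding left_end_def right_end_def by (auto intro!: subsum_mono simp: indicator_def)
  then show ?thesis unfolding cyl_def by auto
qed

lemma cyl_borel [measurable]: "cyl n B \<in> sets borel"
  unfolding cyl_def by simp

lemma cyl_nonempty: "left_end n B \<le> right_end n B"
  unfolding left_end_def right_end_def by (auto intro!: subsum_mono simp: indicator_def)

end

text \<open>
  The growth condition yields \<open>q\<^sub>k\<^sub>+\<^sub>1 \<ge> 2 q\<^sub>k\<close>, which would only bound the tail by the term
  itself. Strictness comes from the next step: \<open>q\<^sub>k\<^sub>+\<^sub>1 \<ge> 2\<close> makes \<open>q\<^sub>k\<^sub>+\<^sub>2 \<ge> 3 q\<^sub>k\<^sub>+\<^sub>1\<close>, so the tail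
  is at most \<open>1/2 + 1/3\<close> of the term.
\<close>
lemma dominating_series_alternating:
  fixes q :: "nat \<Rightarrow> nat"
  assumes q_pos: "\<forall>k\<ge>1. q k > 0"
    and q_growth: "\<forall>k\<ge>1. q (Suc k) \<ge> q k * (q k + 1)"
  shows "dominating_series (\<lambda>k. (-1) ^ k / real (q (Suc k)))"
proof -
  define a where "a k = 1 / real (q (Suc k))" for k
  have pos: "q (Suc k) \<ge> 1" for k using q_pos[rule_format, of "Suc k"] by simp
  have double: "2 * q (Suc k) \<le> q (Suc (Suc k))" for k
  proof -
    have "q (Suc k) * 2 \<le> q (Suc k) * (q (Suc k) + 1)"
      using pos[of k] by (intro mult_left_mono) auto
    then show ?thesis
      using order_trans[OF _ q_growth[rule_format, of "Suc k"]] by (simp add: mult.commute)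
  qed
  have triple: "3 * q (Suc (Suc k)) \<le> q (Suc (Suc (Suc k)))" for k
  proof -
    have "q (Suc (Suc k)) * 3 \<le> q (Suc (Suc k)) * (q (Suc (Suc k)) + 1)"
      using double[of k] pos[of k] by (intro mult_left_mono) auto
    then show ?thesis
      using order_trans[OF _ q_growth[rule_format, of "Suc (Suc k)"]] by (simp add: mult.commute)
  qed
  have a_pos: "a k > 0" for k unfolding a_def using pos[of k] by simp
  have a_half: "a (Suc k) \<le> a k / 2" for k
  proof -
    have "2 * real (q (Suc k)) \<le> real (q (Suc (Suc k)))" using double[of k] by linarith
    then show ?thesis unfolding a_def using pos[of k] pos[of "Suc k"] by (simp add: field_simps)
  qed
  have a_third: "a (Suc (Suc k)) \<le> a (Suc k) / 3" for k
  proof -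
    have "3 * real (q (Suc (Suc k))) \<le> real (q (Suc (Suc (Suc k))))" using triple[of k] by linarith
    then show ?thesis unfolding a_def using pos[of "Suc k"] pos[of "Suc (Suc k)"]
      by (simp add: field_simps)
  qed
  have geo: "a (j + k) \<le> a k * (1/2) ^ j" for j k
  proof (induction j)
    case (Suc j)
    have "a (Suc j + k) \<le> a (j + k) / 2" using a_half[of "j + k"] by simp
    also have "\<dots> \<le> a k * (1/2) ^ j / 2" using Suc by simp
    finally show ?case by simp
  qed simp
  have sum_a: "summable a"
    by (rule summable_comparison_test'[of "\<lambda>j. a 0 * (1/2) ^ j" 0])
      (use geo[of _ 0] a_pos in \<open>auto intro!: summable_mult simp: abs_of_pos\<close>)
  have tail: "(\<Sum>j. a (j + Suc k)) < a k" for k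
  proof -
    have s: "summable (\<lambda>j. a (j + Suc k))" "summable (\<lambda>j. a (j + Suc (Suc k)))"
      using sum_a by (simp_all only: summable_iff_shift)
    have "(\<Sum>j. a (j + Suc (Suc k))) \<le> (\<Sum>j. a (Suc (Suc k)) * (1/2) ^ j)"
      by (intro suminf_le geo s summable_mult) auto
    also have "\<dots> = a (Suc (Suc k)) * 2"
      by (subst suminf_mult) (auto simp: suminf_geometric)
    finally have "(\<Sum>j. a (j + Suc (Suc k))) \<le> 2 * a (Suc (Suc k))" by simp
    moreover have "(\<Sum>j. a (j + Suc k)) = a (Suc k) + (\<Sum>j. a (j + Suc (Suc k)))"
      using suminf_split_head[OF s(1)] by simp
    ultimately show ?thesis
      using a_half[of k] a_third[of k] a_pos[of k] by linarith
  qed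
  have "\<bar>(-1) ^ k / real (q (Suc k))\<bar> = a k" for k
    unfolding a_def by (simp add: power_abs)
  then show ?thesis
    using sum_a tail by unfold_locales simp_all
qed

section \<open>Hausdorff--Billingsley dimension\<close>

lemma HB_measure_eq_0I:
  assumes "\<And>\<epsilon>. \<epsilon> > 0 \<Longrightarrow> HB_premeasure \<nu> \<alpha> \<epsilon> E = 0"
  shows "HB_measure \<nu> \<alpha> E = 0"
  unfolding HB_measure_eq_SUP using assms by (auto intro!: antisym SUP_least)

lemma HB_premeasure_eq_0:
  assumes "HB_measure \<nu> \<alpha> E = 0" "\<epsilon> > 0"
  shows "HB_premeasure \<nu> \<alpha> \<epsilon> E = 0"
proof -
  have "HB_premeasure \<nu> \<alpha> \<epsilon> E \<le> HB_measure \<nu> \<alpha> E"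
    unfolding HB_measure_eq_SUP using assms(2) by (intro SUP_upper) auto
  then show ?thesis using assms(1) by simp
qed

lemma HB_premeasure_le:
  assumes "E \<subseteq> (\<Union>n. {a n..b n})" "\<And>n. measure \<nu> {a n..b n} \<le> \<epsilon>"
  shows "HB_premeasure \<nu> \<alpha> \<epsilon> E \<le> (\<Sum>n. ennreal (measure \<nu> {a n..b n} powr \<alpha>))"
  unfolding HB_premeasure_def by (rule INF_lower2[of "(a, b)"]) (use assms in auto)

lemma HB_measure_mono:
  assumes "E \<subseteq> F" shows "HB_measure \<nu> \<alpha> E \<le> HB_measure \<nu> \<alpha> F"
  unfolding HB_measure_eq_SUP
proof (rule SUP_mono)
  fix \<epsilon> :: real assume "\<epsilon> \<in> {0<..}"
  have "HB_premeasure \<nu> \<alpha> \<epsilon> E \<le> HB_premeasure \<nu> \<alpha> \<epsilon> F"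
    unfolding HB_premeasure_def by (rule INF_superset_mono) (use assms in auto)
  then show "\<exists>\<delta>\<in>{0<..}. HB_premeasure \<nu> \<alpha> \<epsilon> E \<le> HB_premeasure \<nu> \<alpha> \<delta> F"
    using \<open>\<epsilon> \<in> {0<..}\<close> by blast
qed

lemma HB_dim_mono:
  assumes "E \<subseteq> F" shows "HB_dim E \<nu> \<le> HB_dim F \<nu>"
  unfolding HB_dim_def
proof (rule Inf_superset_mono, rule Collect_mono, safe)
  fix \<alpha> :: real assume "HB_measure \<nu> \<alpha> F = 0" "\<alpha> > 0"
  then show "\<exists>\<alpha>'. ereal \<alpha> = ereal \<alpha>' \<and> 0 < \<alpha>' \<and> HB_measure \<nu> \<alpha>' E = 0"
    using HB_measure_mono[OF assms, of \<nu> \<alpha>] by auto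
qed

lemma HB_dim_le:
  assumes "0 \<le> d" and "\<And>\<alpha>. \<alpha> > d \<Longrightarrow> HB_measure \<nu> \<alpha> E = 0"
  shows "HB_dim E \<nu> \<le> ereal d"
proof (rule ereal_le_epsilon2)
  fix e :: real assume "e > 0"
  then show "HB_dim E \<nu> \<le> ereal d + ereal e"
    unfolding HB_dim_def using assms(1) by (intro Inf_lower) (auto intro!: assms(2))
qed

text \<open>
  For exponents \<open>\<alpha> \<le> 1\<close> the terms \<open>\<mu>(I) ^ \<alpha>\<close> are at least \<open>\<mu>(I)\<close>, and the measures of the
  intervals of a covering of \<open>E\<close> sum to at least \<open>1\<close>.
\<close>
lemma HB_dim_ge_1:
  assumes "prob_space \<mu>" and sets: "sets \<mu> = sets borel"
    and E: "E \<in> sets borel" "measure \<mu> E = 1"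
  shows "1 \<le> HB_dim E \<mu>"
proof -
  interpret prob_space \<mu> by fact
  have "\<alpha> > 1" if \<alpha>: "\<alpha> > 0" "HB_measure \<mu> \<alpha> E = 0" for \<alpha>
  proof (rule ccontr)
    assume "\<not> \<alpha> > 1"
    then have "\<alpha> \<le> 1" by simp
    have "1 \<le> HB_premeasure \<mu> \<alpha> 1 E"
      unfolding HB_premeasure_def
    proof (rule INF_greatest, clarify)
      fix a b :: "nat \<Rightarrow> real"
      assume cover: "E \<subseteq> (\<Union>n. {a n..b n})"
      have "1 = emeasure \<mu> E" using E(2) by (simp add: emeasure_eq_measure)
      also have "\<dots> \<le> emeasure \<mu> (\<Union>n. {a n..b n})"
        using cover E(1) by (intro emeasure_mono) (auto simp: sets)
      also have "\<dots> \<le> (\<Sum>n. emeasure \<mu> {a n..b n})"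
        by (intro emeasure_subadditive_countably) (auto simp: sets)
      also have "\<dots> \<le> (\<Sum>n. ennreal (measure \<mu> {a n..b n} powr \<alpha>))"
      proof (intro suminf_le)
        fix n
        have "measure \<mu> {a n..b n} \<le> measure \<mu> {a n..b n} powr \<alpha>"
        proof (cases "measure \<mu> {a n..b n} = 0")
          case False
          then have "measure \<mu> {a n..b n} powr 1 \<le> measure \<mu> {a n..b n} powr \<alpha>"
            using \<open>\<alpha> \<le> 1\<close> by (intro powr_mono') auto
          then show ?thesis by simp
        qed simp
        then show "emeasure \<mu> {a n..b n} \<le> ennreal (measure \<mu> {a n..b n} powr \<alpha>)"
          by (simp add: emeasure_eq_measure ennreal_leI)
      qed auto
      finally show "1 \<le> (\<Sum>n. ennreal (measure \<mu> {a n..b n} powr \<alpha>))" .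
    qed
    moreover have "HB_premeasure \<mu> \<alpha> 1 E = 0"
      using HB_premeasure_eq_0[OF \<alpha>(2)] by simp
    ultimately show False by simp
  qed
  then show ?thesis
    unfolding HB_dim_def by (intro Inf_greatest) (auto simp: less_imp_le)
qed

text \<open>
  A covering that is fine for \<open>\<mu>\<close> is then fine for \<open>\<nu>\<close>, and its sum for \<open>\<nu>\<close> with
  exponent \<open>\<alpha> / (1 - \<delta>)\<close> is at most its sum for \<open>\<mu>\<close> with exponent \<open>\<alpha>\<close>. Letting \<open>\<delta>\<close> tend
  to \<open>0\<close> compares the dimensions.
\<close>
lemma HB_dim_le_of_interval_powr:
  assumes fin: "finite_measure \<mu>"
    and cmp: "\<And>\<delta>. 0 < \<delta> \<Longrightarrow> \<delta> < 1 \<Longrightarrow> \<exists>\<epsilon>>0. \<forall>x y. measure \<mu> {x..y} \<le> \<epsilon> \<longrightarrow>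
             measure \<nu> {x..y} \<le> measure \<mu> {x..y} powr (1 - \<delta>)"
  shows "HB_dim E \<nu> \<le> HB_dim E \<mu>"
proof -
  have zero: "HB_measure \<nu> (\<alpha> / (1 - \<delta>)) E = 0"
    if \<alpha>: "\<alpha> > 0" "HB_measure \<mu> \<alpha> E = 0" and \<delta>: "0 < \<delta>" "\<delta> < 1" for \<alpha> \<delta>
  proof (rule HB_measure_eq_0I)
    fix \<eta> :: real assume "\<eta> > 0"
    obtain \<epsilon> where \<epsilon>: "\<epsilon> > 0" and le: "\<And>x y. measure \<mu> {x..y} \<le> \<epsilon> \<Longrightarrow>
        measure \<nu> {x..y} \<le> measure \<mu> {x..y} powr (1 - \<delta>)"
      using cmp[OF \<delta>] by blast
    define \<epsilon>' where "\<epsilon>' = min \<epsilon> (\<eta> powr (1 / (1 - \<delta>)))"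
    have \<epsilon>': "\<epsilon>' > 0" using \<epsilon> \<open>\<eta> > 0\<close> by (simp add: \<epsilon>'_def)
    have "HB_premeasure \<nu> (\<alpha> / (1 - \<delta>)) \<eta> E \<le> HB_premeasure \<mu> \<alpha> \<epsilon>' E"
      unfolding HB_premeasure_def[of \<mu>]
    proof (rule INF_greatest, clarify)
      fix a b :: "nat \<Rightarrow> real"
      assume cover: "E \<subseteq> (\<Union>n. {a n..b n})" and small: "\<forall>n. measure \<mu> {a n..b n} \<le> \<epsilon>'"
      have le': "measure \<nu> {a n..b n} \<le> measure \<mu> {a n..b n} powr (1 - \<delta>)" for n
        using small[rule_format, of n] by (intro le) (auto simp: \<epsilon>'_def)
      have "HB_premeasure \<nu> (\<alpha> / (1 - \<delta>)) \<eta> E \<le>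
          (\<Sum>n. ennreal (measure \<nu> {a n..b n} powr (\<alpha> / (1 - \<delta>))))"
      proof (rule HB_premeasure_le[OF cover])
        fix n
        have "measure \<nu> {a n..b n} \<le> measure \<mu> {a n..b n} powr (1 - \<delta>)" by (rule le')
        also have "\<dots> \<le> (\<eta> powr (1 / (1 - \<delta>))) powr (1 - \<delta>)"
          using small[rule_format, of n] \<delta> by (intro powr_mono2) (auto simp: \<epsilon>'_def)
        also have "\<dots> = \<eta>" using \<delta> \<open>\<eta> > 0\<close> by (simp add: powr_powr)
        finally show "measure \<nu> {a n..b n} \<le> \<eta>" .
      qed
      also have "\<dots> \<le> (\<Sum>n. ennreal (measure \<mu> {a n..b n} powr \<alpha>))"
      proof (intro suminf_le ennreal_leI)
        fix n
        have "measure \<nu> {a n..b n} powr (\<alpha> / (1 - \<delta>)) \<le>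
            (measure \<mu> {a n..b n} powr (1 - \<delta>)) powr (\<alpha> / (1 - \<delta>))"
          using le'[of n] \<alpha> \<delta> by (intro powr_mono2) auto
        also have "\<dots> = measure \<mu> {a n..b n} powr \<alpha>" using \<delta> by (simp add: powr_powr)
        finally show "measure \<nu> {a n..b n} powr (\<alpha> / (1 - \<delta>)) \<le> measure \<mu> {a n..b n} powr \<alpha>" .
      qed auto
      finally show "HB_premeasure \<nu> (\<alpha> / (1 - \<delta>)) \<eta> E \<le>
        (\<Sum>n. ennreal (measure \<mu> {a n..b n} powr \<alpha>))" .
    qed
    then show "HB_premeasure \<nu> (\<alpha> / (1 - \<delta>)) \<eta> E = 0"
      using HB_premeasure_eq_0[OF \<alpha>(2) \<epsilon>'] by simp
  qed
  show ?thesis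
    unfolding HB_dim_def[of E \<mu>]
  proof (rule Inf_greatest, safe)
    fix \<alpha> :: real assume \<alpha>: "\<alpha> > 0" "HB_measure \<mu> \<alpha> E = 0"
    have "HB_measure \<nu> \<beta> E = 0" if "\<beta> > \<alpha>" for \<beta>
      using zero[OF \<alpha>, of "1 - \<alpha> / \<beta>"] that \<alpha>(1) by simp
    then show "HB_dim E \<nu> \<le> ereal \<alpha>"
      using \<alpha> by (intro HB_dim_le) auto
  qed
qed

section \<open>Product weights on binary words\<close>

definition word_weight :: "(nat \<Rightarrow> bool \<Rightarrow> real) \<Rightarrow> nat \<Rightarrow> nat set \<Rightarrow> real" where
  "word_weight w n B = (\<Prod>k<n. w k (k \<in> B))"

lemma sum_Pow_lessThan_Suc:
  fixes f :: "nat set \<Rightarrow> 'a::comm_monoid_add"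
  shows "(\<Sum>B\<in>Pow {..<Suc n}. f B) = (\<Sum>B\<in>Pow {..<n}. f B + f (insert n B))"
proof -
  have inj: "inj_on (insert n) (Pow {..<n})"
    by (rule inj_onI) (auto simp: insert_ident)
  have "(\<Sum>B\<in>Pow {..<Suc n}. f B) = (\<Sum>B\<in>Pow {..<n} \<union> insert n ` Pow {..<n}. f B)"
    by (simp add: lessThan_Suc Pow_insert)
  also have "\<dots> = (\<Sum>B\<in>Pow {..<n}. f B) + (\<Sum>B\<in>insert n ` Pow {..<n}. f B)"
    by (intro sum.union_disjoint) auto
  also have "(\<Sum>B\<in>insert n ` Pow {..<n}. f B) = (\<Sum>B\<in>Pow {..<n}. f (insert n B))"
    by (simp add: sum.reindex[OF inj])
  finally show ?thesis by (simp add: sum.distrib)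
qed

lemma prod_digits_insert:
  fixes f :: "nat \<Rightarrow> bool \<Rightarrow> 'a::comm_monoid_mult"
  shows "(\<Prod>k<n. f k (k \<in> insert n B)) = (\<Prod>k<n. f k (k \<in> B))"
  by (rule prod.cong) auto

lemma sum_digits_insert:
  fixes f :: "nat \<Rightarrow> bool \<Rightarrow> 'a::comm_monoid_add"
  shows "(\<Sum>k<n. f k (k \<in> insert n B)) = (\<Sum>k<n. f k (k \<in> B))"
  by (rule sum.cong) auto

lemma word_weight_Suc:
  assumes "B \<subseteq> {..<n}"
  shows "word_weight w (Suc n) B = word_weight w n B * w n False"
    and "word_weight w (Suc n) (insert n B) = word_weight w n B * w n True"
proof -
  have "n \<notin> B" using assms by blast
  then show "word_weight w (Suc n) B = word_weight w n B * w n False"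
    "word_weight w (Suc n) (insert n B) = word_weight w n B * w n True"
    unfolding word_weight_def prod.lessThan_Suc prod_digits_insert by auto
qed

lemma sum_word_weight:
  assumes "\<And>k. w k False + w k True = 1"
  shows "(\<Sum>B\<in>Pow {..<n}. word_weight w n B) = 1"
proof (induction n)
  case 0 then show ?case by (simp add: word_weight_def)
next
  case (Suc n)
  have "(\<Sum>B\<in>Pow {..<Suc n}. word_weight w (Suc n) B)
      = (\<Sum>B\<in>Pow {..<n}. word_weight w n B * (w n False + w n True))"
    unfolding sum_Pow_lessThan_Suc by (intro sum.cong) (auto simp: word_weight_Suc algebra_simps)
  then show ?case using Suc assms by simp
qed

text \<open>
  The variance of a sum of independent centred variables is the sum of the variances. The first
  moment is carried along because it makes the cross terms vanish in the induction.
\<close>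
lemma sum_word_weight_second_moment:
  assumes total: "\<And>k. w k False + w k True = 1"
    and centred: "\<And>k. w k False * d k False + w k True * d k True = 0"
  shows "(\<Sum>B\<in>Pow {..<n}. word_weight w n B * (\<Sum>k<n. d k (k \<in> B))) = 0"
    and "(\<Sum>B\<in>Pow {..<n}. word_weight w n B * (\<Sum>k<n. d k (k \<in> B))\<^sup>2) =
      (\<Sum>k<n. w k False * (d k False)\<^sup>2 + w k True * (d k True)\<^sup>2)"
proof (induction n)
  case 0
  { case 1 then show ?case by simp next case 2 then show ?case by simp }
next
  case (Suc n)
  define D where "D B = (\<Sum>k<n. d k (k \<in> B))" for B
  have D: "(\<Sum>k<Suc n. d k (k \<in> B)) = D B + d n False"
    "(\<Sum>k<Suc n. d k (k \<in> insert n B)) = D B + d n True" if "B \<in> Pow {..<n}" for B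
  proof -
    have "n \<notin> B" using that by blast
    then show "(\<Sum>k<Suc n. d k (k \<in> B)) = D B + d n False"
      "(\<Sum>k<Suc n. d k (k \<in> insert n B)) = D B + d n True"
      unfolding D_def sum.lessThan_Suc sum_digits_insert by auto
  qed
  note IH = Suc[folded D_def]
  let ?P = "Pow {..<n}" and ?W = "word_weight w n"
  { case 1
    have "(\<Sum>B\<in>Pow {..<Suc n}. word_weight w (Suc n) B * (\<Sum>k<Suc n. d k (k \<in> B)))
      = (\<Sum>B\<in>?P. ?W B * D B * (w n False + w n True)
          + ?W B * (w n False * d n False + w n True * d n True))"
      unfolding sum_Pow_lessThan_Suc
      by (intro sum.cong refl) (simp only: D, simp add: word_weight_Suc algebra_simps)
    then show ?case using IH total centred by simp
  next
    case 2
    have "(\<Sum>B\<in>Pow {..<Suc n}. word_weight w (Suc n) B * (\<Sum>k<Suc n. d k (k \<in> B))\<^sup>2)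
      = (\<Sum>B\<in>?P. ?W B * (D B)\<^sup>2 * (w n False + w n True)
          + ?W B * (2 * D B) * (w n False * d n False + w n True * d n True)
          + ?W B * (w n False * (d n False)\<^sup>2 + w n True * (d n True)\<^sup>2))"
      unfolding sum_Pow_lessThan_Suc
      by (intro sum.cong refl)
        (simp only: D, simp add: word_weight_Suc algebra_simps power2_eq_square)
    also have "\<dots> = (\<Sum>B\<in>?P. ?W B * (D B)\<^sup>2) +
        (\<Sum>B\<in>?P. ?W B) * (w n False * (d n False)\<^sup>2 + w n True * (d n True)\<^sup>2)"
      using total centred by (simp add: sum.distrib sum_distrib_right)
    finally show ?case
      using IH sum_word_weight[of w, OF total] by simp
  }
qed

section \<open>Comparing product laws on intervals\<close>

text \<open>The words of length \<open>n\<close> uniformly have weight \<open>2 ^ (- n (1 + o(1)))\<close>.\<close>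
definition log_dyadic :: "(nat \<Rightarrow> bool \<Rightarrow> real) \<Rightarrow> bool" where
  "log_dyadic w \<longleftrightarrow> (\<forall>\<tau>>0. \<exists>N. \<forall>n\<ge>N. \<forall>B\<subseteq>{..<n}.
     exp (- (real n * (ln 2 + \<tau>))) \<le> word_weight w n B \<and>
     word_weight w n B \<le> exp (- (real n * (ln 2 - \<tau>))))"

context dominating_series
begin

definition product_law :: "real measure \<Rightarrow> (nat \<Rightarrow> bool \<Rightarrow> real) \<Rightarrow> bool" where
  "product_law m w \<longleftrightarrow> prob_space m \<and> sets m = sets borel \<and>
     (\<forall>n. \<forall>B\<subseteq>{..<n}. measure m (cyl n B) = word_weight w n B)"

lemma measure_Union_cyl:
  assumes m: "product_law m w" and G: "G \<subseteq> Pow {..<n}"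
  shows "measure m (\<Union>B\<in>G. cyl n B) = (\<Sum>B\<in>G. word_weight w n B)"
proof -
  interpret m: prob_space m using m unfolding product_law_def by blast
  have [simp]: "sets m = sets borel" using m unfolding product_law_def by blast
  have "finite G" using G by (rule finite_subset) simp
  then have "measure m (\<Union>B\<in>G. cyl n B) = (\<Sum>B\<in>G. measure m (cyl n B))"
    using G cyl_disjoint[of _ n]
    by (intro m.finite_measure_finite_Union) (auto simp: disjoint_family_on_def cyl_borel)
  also have "\<dots> = (\<Sum>B\<in>G. word_weight w n B)"
    using m G unfolding product_law_def by (intro sum.cong) auto
  finally show ?thesis .
qed

lemma measure_all_cyl:
  assumes m: "product_law m w" and total: "\<And>k. w k False + w k True = 1"
  shows "measure m (\<Union>B\<in>Pow {..<n}. cyl n B) = 1"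
  using measure_Union_cyl[OF m subset_refl] sum_word_weight[of w, OF total] by simp

text \<open>
  A cylinder strictly between two others that the interval meets would lie inside the interval,
  which has too little measure for that. So the interval meets only the leftmost and the rightmost
  of its cylinders.
\<close>
lemma interval_measure_le_two_cyl:
  assumes m1: "product_law m1 w1" and m2: "product_law m2 w2"
    and total: "\<And>k. w2 k False + w2 k True = 1"
    and small: "\<And>B. B \<subseteq> {..<n} \<Longrightarrow> measure m1 {x..y} < word_weight w1 n B"
    and bound: "\<And>B. B \<subseteq> {..<n} \<Longrightarrow> word_weight w2 n B \<le> u"
  shows "measure m2 {x..y} \<le> 2 * u"
proof -
  interpret m1: prob_space m1 using m1 unfolding product_law_def by blast
  interpret m2: prob_space m2 using m2 unfolding product_law_def by blast
  have s1[simp]: "sets m1 = sets borel" using m1 unfolding product_law_def by blast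
  have s2[simp]: "sets m2 = sets borel" using m2 unfolding product_law_def by blast
  have sp[simp]: "space m2 = UNIV" using sets_eq_imp_space_eq[OF s2] by simp
  have w1: "measure m1 (cyl n B) = word_weight w1 n B" if "B \<subseteq> {..<n}" for B
    using m1 that unfolding product_law_def by blast
  have w2: "measure m2 (cyl n B) \<le> u" if "B \<subseteq> {..<n}" for B
    using m2 that bound unfolding product_law_def by force
  have "0 \<le> measure m2 (cyl n {})" by simp
  also have "\<dots> \<le> u" by (rule w2) simp
  finally have u: "0 \<le> u" .
  define W where "W = {B. B \<subseteq> {..<n} \<and> cyl n B \<inter> {x..y} \<noteq> {}}"
  have finW: "finite W" unfolding W_def by (rule finite_subset[of _ "Pow {..<n}"]) auto
  have cover: "AE z in m2. z \<in> (\<Union>B\<in>Pow {..<n}. cyl n B)"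
    by (rule m2.AE_prob_1) (rule measure_all_cyl[OF m2 total])
  then have le: "measure m2 {x..y} \<le> measure m2 (\<Union>B\<in>W. cyl n B)"
  proof (intro m2.finite_measure_mono_AE)
    have in_W: "z \<in> (\<Union>B\<in>W. cyl n B)" if z: "z \<in> (\<Union>B\<in>Pow {..<n}. cyl n B)" "z \<in> {x..y}" for z
    proof -
      obtain B where "B \<subseteq> {..<n}" "z \<in> cyl n B" using z(1) by auto
      then have "B \<in> W" using z(2) unfolding W_def by blast
      then show ?thesis using \<open>z \<in> cyl n B\<close> by (rule UN_I)
    qed
    show "AE z in m2. z \<in> {x..y} \<longrightarrow> z \<in> (\<Union>B\<in>W. cyl n B)"
      by (rule eventually_mono[OF cover]) (rule impI, rule in_W)
    show "(\<Union>B\<in>W. cyl n B) \<in> sets m2"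
      unfolding s2 by (intro sets.finite_UN finW cyl_borel)
  qed
  show ?thesis
  proof (cases "W = {}")
    case True
    then show ?thesis using le u by simp
  next
    case False
    have "Min (left_end n ` W) \<in> left_end n ` W" "Max (right_end n ` W) \<in> right_end n ` W"
      using finW False by simp_all
    then obtain B1 B2 where B: "B1 \<in> W" "left_end n B1 = Min (left_end n ` W)"
      "B2 \<in> W" "right_end n B2 = Max (right_end n ` W)" by (elim imageE) simp
    then have B1: "B1 \<in> W" "\<And>B. B \<in> W \<Longrightarrow> left_end n B1 \<le> left_end n B"
      and B2: "B2 \<in> W" "\<And>B. B \<in> W \<Longrightarrow> right_end n B \<le> right_end n B2"
      using finW by simp_all
    have "W \<subseteq> {B1, B2}"
    proof
      fix B assume B: "B \<in> W"
      show "B \<in> {B1, B2}"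
      proof (rule ccontr)
        assume nB: "B \<notin> {B1, B2}"
        have sub: "B \<subseteq> {..<n}" "B1 \<subseteq> {..<n}" "B2 \<subseteq> {..<n}"
          using B B1(1) B2(1) by (simp_all add: W_def)
        have "right_end n B1 < left_end n B"
          using cyl_separated[OF sub(2) sub(1)] B1(2)[OF B] cyl_nonempty[of n B] nB by fastforce
        moreover have "right_end n B < left_end n B2"
          using cyl_separated[OF sub(1) sub(3)] B2(2)[OF B] cyl_nonempty[of n B] nB by fastforce
        moreover have "x \<le> right_end n B1" "left_end n B2 \<le> y"
          using B1(1) B2(1) by (auto simp: W_def cyl_def)
        ultimately have "cyl n B \<subseteq> {x..y}" by (auto simp: cyl_def)
        then have "measure m1 (cyl n B) \<le> measure m1 {x..y}"
          by (intro m1.finite_measure_mono) auto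
        then show False using small[of B] w1[of B] B by (auto simp: W_def)
      qed
    qed
    then have "measure m2 (\<Union>B\<in>W. cyl n B) \<le> measure m2 (cyl n B1 \<union> cyl n B2)"
      by (intro m2.finite_measure_mono) (auto simp: cyl_borel)
    also have "\<dots> \<le> measure m2 (cyl n B1) + measure m2 (cyl n B2)"
      by (intro measure_Un_le) (auto simp: cyl_borel)
    also have "\<dots> \<le> u + u" using B1(1) B2(1) by (intro add_mono w2) (auto simp: W_def)
    finally show ?thesis using le by simp
  qed
qed

text \<open>
  The rank \<open>n\<close> is chosen as the last one at which the interval is lighter than the lower bound
  for cylinders under the first law. Its measure for the second law is then at most twice that of a cylinder of rank
  \<open>n\<close>, while its measure for the first law is at least that lower bound at rank \<open>n + 1\<close>. Both are
  \<open>2 ^ (- n (1 + o(1)))\<close>. An interval of measure \<open>0\<close> for the first law is below the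
  bounds of all ranks, so its measure for the second law is \<open>0\<close> too.
\<close>
lemma interval_measure_le_powr:
  assumes m1: "product_law m1 w1" and m2: "product_law m2 w2"
    and total: "\<And>k. w2 k False + w2 k True = 1"
    and dy: "log_dyadic w1" "log_dyadic w2"
    and \<delta>: "0 < \<delta>" "\<delta> < 1"
  shows "\<exists>\<epsilon>>0. \<forall>x y. measure m1 {x..y} \<le> \<epsilon> \<longrightarrow>
     measure m2 {x..y} \<le> measure m1 {x..y} powr (1 - \<delta>)"
proof -
  \<comment> \<open>The exponent \<open>1 - \<delta>\<close> gains \<open>\<delta> ln 2\<close> per rank, and the errors cost less than \<open>2 \<tau>\<close>.\<close>
  define \<tau> where "\<tau> = \<delta> * ln 2 / 4"
  have \<tau>: "\<tau> > 0" "\<tau> < ln 2" using \<delta> by (auto simp: \<tau>_def field_simps)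
  define l where "l n = exp (- (real n * (ln 2 + \<tau>)))" for n
  define u where "u n = exp (- (real n * (ln 2 - \<tau>)))" for n
  obtain N1 where N1: "\<And>n B. n \<ge> N1 \<Longrightarrow> B \<subseteq> {..<n} \<Longrightarrow> l n \<le> word_weight w1 n B"
    using dy(1) \<tau>(1) unfolding log_dyadic_def l_def by meson
  obtain N2 where N2: "\<And>n B. n \<ge> N2 \<Longrightarrow> B \<subseteq> {..<n} \<Longrightarrow> word_weight w2 n B \<le> u n"
    using dy(2) \<tau>(1) unfolding log_dyadic_def u_def by meson
  define N where "N = max (nat \<lceil>4 / \<delta>\<rceil>) (max N1 N2)"
  have key: "2 * u n \<le> l (Suc n) powr (1 - \<delta>)" if "n \<ge> N" for n
  proof -
    have "4 / \<delta> \<le> real n" using that unfolding N_def by linarith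
    then have n: "4 \<le> real n * \<delta>" using \<delta> by (simp add: field_simps)
    have t1: "\<tau> * (2 - \<delta>) \<le> \<delta> * ln 2 / 2"
      using mult_left_mono[of "2 - \<delta>" 2 \<tau>] \<tau> \<delta> by (simp add: \<tau>_def)
    have "4 * ln 2 \<le> (real n * \<delta>) * ln (2::real)"
      using n by (intro mult_right_mono) auto
    then have "2 * ln 2 \<le> real n * (\<delta> * ln 2 / 2)" by simp
    also have "\<dots> \<le> real (Suc n) * (\<delta> * ln 2 / 2)" using \<delta> by (intro mult_right_mono) auto
    also have "\<dots> \<le> real (Suc n) * (\<delta> * ln 2 - \<tau> * (2 - \<delta>))"
      using t1 by (intro mult_left_mono) auto
    finally have main: "2 * ln 2 \<le> real (Suc n) * (\<delta> * ln 2 - \<tau> * (2 - \<delta>))" .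
    have "ln 2 - real n * (ln 2 - \<tau>) \<le> (1 - \<delta>) * - (real (Suc n) * (ln 2 + \<tau>))"
      using main \<tau> by (simp add: algebra_simps)
    then have "exp (ln 2 - real n * (ln 2 - \<tau>)) \<le> exp ((1 - \<delta>) * - (real (Suc n) * (ln 2 + \<tau>)))"
      by simp
    moreover have "exp (ln 2 - real n * (ln 2 - \<tau>)) = 2 * u n"
      unfolding u_def by (simp only: diff_conv_add_uminus exp_add) simp
    moreover have "exp ((1 - \<delta>) * - (real (Suc n) * (ln 2 + \<tau>))) = l (Suc n) powr (1 - \<delta>)"
      unfolding l_def by (simp only: powr_def ln_exp exp_not_eq_zero if_False)
    ultimately show ?thesis by simp
  qed
  have two: "measure m2 {x..y} \<le> 2 * u n" if "n \<ge> N" "measure m1 {x..y} < l n" for n x y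
    using that N1[of n] N2[of n] unfolding N_def
    by (intro interval_measure_le_two_cyl[OF m1 m2 total, where n=n]) (auto intro: less_le_trans)
  have l0: "l \<longlonglongrightarrow> 0"
  proof -
    have "l = (\<lambda>n. exp (- (ln 2 + \<tau>)) ^ n)"
      unfolding l_def by (rule ext) (simp only: exp_of_nat_mult[symmetric] mult_minus_right)
    moreover have "(\<lambda>n. exp (- (ln 2 + \<tau>)) ^ n) \<longlonglongrightarrow> 0"
      using \<tau> by (intro LIMSEQ_realpow_zero) (auto intro: add_pos_pos)
    ultimately show ?thesis by simp
  qed
  have l_pos: "l n > 0" for n unfolding l_def by simp
  show ?thesis
  proof (intro exI[of _ "l N / 2"] conjI allI impI)
    show "l N / 2 > 0" using l_pos by simp
    fix x y assume small: "measure m1 {x..y} \<le> l N / 2"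
    define t where "t = measure m1 {x..y}"
    have tN: "t < l N" using small l_pos[of N] unfolding t_def by linarith
    have "t \<ge> 0" unfolding t_def by simp
    show "measure m2 {x..y} \<le> measure m1 {x..y} powr (1 - \<delta>)"
    proof (cases "t = 0")
      case True
      have "measure m2 {x..y} \<le> 0"
      proof (rule LIMSEQ_le_const)
        have "((\<lambda>n. l (Suc n)) \<longlongrightarrow> 0) sequentially" by (rule LIMSEQ_Suc[OF l0])
        then show "(\<lambda>n. l (Suc n) powr (1 - \<delta>)) \<longlonglongrightarrow> 0"
          using \<delta> tendsto_powr'[of "\<lambda>n. l (Suc n)" 0 sequentially "\<lambda>_. 1 - \<delta>" "1 - \<delta>"] l_pos
          by (simp add: less_imp_le)
        show "\<exists>K. \<forall>n\<ge>K. measure m2 {x..y} \<le> l (Suc n) powr (1 - \<delta>)"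
          using two key l_pos True unfolding t_def by (metis order_trans)
      qed
      then show ?thesis using True by (simp add: t_def)
    next
      case False
      with \<open>t \<ge> 0\<close> have "t > 0" by simp
      then have "eventually (\<lambda>n. l n < t) sequentially" using order_tendstoD(2)[OF l0] by simp
      then obtain n0 where "n0 \<ge> N" "l n0 < t"
        unfolding eventually_sequentially by (meson max.cobounded1 max.cobounded2)
      then have ex: "\<exists>j. l (N + j) \<le> t" by (metis le_add_diff_inverse less_imp_le)
      define j where "j = (LEAST j. l (N + j) \<le> t)"
      have lj: "l (N + j) \<le> t" unfolding j_def using LeastI_ex[OF ex] .
      have "j \<noteq> 0" using lj tN by (cases j) auto
      then obtain i where i: "j = Suc i" by (cases j) auto
      have "t < l (N + i)"
        using not_less_Least[of i "\<lambda>j. l (N + j) \<le> t"] i unfolding j_def by simp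
      then have "measure m2 {x..y} \<le> 2 * u (N + i)" unfolding t_def by (intro two) auto
      also have "\<dots> \<le> l (Suc (N + i)) powr (1 - \<delta>)" by (rule key) simp
      also have "\<dots> \<le> t powr (1 - \<delta>)" using lj i \<delta> l_pos by (intro powr_mono2) (auto simp: less_imp_le)
      finally show ?thesis by (simp add: t_def)
    qed
  qed
qed

lemma HB_dim_le_of_log_dyadic:
  assumes "product_law m1 w1" "product_law m2 w2"
    and "\<And>k. w2 k False + w2 k True = 1"
    and "log_dyadic w1" "log_dyadic w2"
  shows "HB_dim E m2 \<le> HB_dim E m1"
proof (rule HB_dim_le_of_interval_powr)
  show "finite_measure m1"
    using assms(1) unfolding product_law_def by (simp add: prob_space_def)
qed (rule interval_measure_le_powr[OF assms])

section \<open>Upper bounds from limsup sets\<close>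

text \<open>
  The selected cylinders of all ranks from \<open>N\<close> on cover \<open>E\<close>. Those of rank \<open>n\<close> contribute at most
  \<open>2 ^ (n d) * 2 ^ (- n \<alpha>)\<close>, so for \<open>\<alpha> > d\<close> the sum is the tail of a geometric series.
\<close>
lemma limsup_cyl_dim_le:
  assumes \<nu>: "product_law \<nu> (\<lambda>_ _. 1/2)" and d: "0 \<le> d"
    and G: "\<And>n. G n \<subseteq> Pow {..<n}" and card: "\<And>n. real (card (G n)) \<le> 2 powr (real n * d)"
    and E: "E \<subseteq> (\<Inter>N. \<Union>n\<in>{N..}. \<Union>B\<in>G n. cyl n B)"
  shows "HB_dim E \<nu> \<le> ereal d"
proof (rule HB_dim_le[OF d], rule HB_measure_eq_0I)
  fix \<alpha> \<epsilon> :: real assume \<alpha>: "\<alpha> > d" and \<epsilon>: "\<epsilon> > 0"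
  define x where "x = 2 powr (d - \<alpha>)"
  have x: "0 < x" "x < 1" unfolding x_def using \<alpha> by (auto simp: powr_less_one)
  have fin: "finite (G n)" for n using G by (rule finite_subset) simp
  have bij: "\<exists>e. bij_betw e {..<card (G n)} (G n)" for n
    using ex_bij_betw_nat_finite[OF fin] by (simp add: atLeast0LessThan)
  then obtain e where e: "\<And>n. bij_betw (e n) {..<card (G n)} (G n)" by metis
  have meas: "measure \<nu> (cyl n B) = (1/2) ^ n" if "B \<in> G n" for n B
  proof -
    have "B \<subseteq> {..<n}" using that G[of n] by blast
    then show ?thesis using \<nu> unfolding product_law_def word_weight_def by simp
  qed
  have bound: "HB_premeasure \<nu> \<alpha> \<epsilon> E \<le> ennreal (x ^ N / (1 - x))" if N: "(1/2) ^ N \<le> \<epsilon>" for N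
  proof -
    \<comment> \<open>The selected cylinders, listed rank by rank and padded with empty intervals.\<close>
    define I where "I = (\<lambda>(n, i). if N \<le> n \<and> i < card (G n) then cyl n (e n i) else {})"
    have I: "\<exists>a b. I z = {a..b}" for z
    proof -
      have "\<exists>a b. {} = {a..b::real}" by (intro exI[of _ 1] exI[of _ 0]) simp
      then show ?thesis by (cases z) (simp only: I_def cyl_def split: if_splits, auto)
    qed
    then obtain a b where ab: "\<And>z. I z = {a z..b z}" by metis
    have "HB_premeasure \<nu> \<alpha> \<epsilon> E \<le>
        (\<Sum>j. ennreal (measure \<nu> {a (prod_decode j)..b (prod_decode j)} powr \<alpha>))"
    proof (rule HB_premeasure_le)
      show "E \<subseteq> (\<Union>j. {a (prod_decode j)..b (prod_decode j)})"
      proof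
        fix z assume "z \<in> E"
        then obtain n B where n: "n \<ge> N" "B \<in> G n" "z \<in> cyl n B" using E by blast
        then have "B \<in> e n ` {..<card (G n)}"
          using bij_betw_imp_surj_on[OF e[of n]] by simp
        then obtain i where "i < card (G n)" "e n i = B" by auto
        then have "z \<in> I (n, i)" using n by (simp add: I_def)
        then have "z \<in> {a (prod_decode j)..b (prod_decode j)}" if "j = prod_encode (n, i)" for j
          using that by (simp flip: ab)
        then show "z \<in> (\<Union>j. {a (prod_decode j)..b (prod_decode j)})" by blast
      qed
      fix j
      obtain n i where ni: "prod_decode j = (n, i)" by force
      have "measure \<nu> (I (n, i)) \<le> \<epsilon>"
      proof (cases "N \<le> n \<and> i < card (G n)")
        case True
        then have "measure \<nu> (I (n, i)) = (1/2) ^ n"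
          using meas e[of n] unfolding bij_betw_def I_def by auto
        also have "\<dots> \<le> (1/2) ^ N" using True by (intro power_decreasing) auto
        finally show ?thesis using N by simp
      qed (use \<epsilon> in \<open>auto simp: I_def\<close>)
      then show "measure \<nu> {a (prod_decode j)..b (prod_decode j)} \<le> \<epsilon>"
        by (simp add: ni flip: ab)
    qed
    also have "\<dots> = (\<Sum>j. ennreal (measure \<nu> (I (prod_decode j)) powr \<alpha>))"
      by (simp add: ab)
    also have "\<dots> = (\<Sum>n. \<Sum>i. ennreal (measure \<nu> (I (n, i)) powr \<alpha>))"
      by (rule suminf_ennreal_2dimen[where f="\<lambda>z. ennreal (measure \<nu> (I z) powr \<alpha>)"]) simp
    also have "\<dots> \<le> (\<Sum>n. if N \<le> n then ennreal (x ^ n) else 0)"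
    proof (intro suminf_le)
      fix n
      show "(\<Sum>i. ennreal (measure \<nu> (I (n, i)) powr \<alpha>)) \<le> (if N \<le> n then ennreal (x ^ n) else 0)"
      proof (cases "N \<le> n")
        case True
        have "(\<Sum>i. ennreal (measure \<nu> (I (n, i)) powr \<alpha>)) =
            (\<Sum>i<card (G n). ennreal (measure \<nu> (I (n, i)) powr \<alpha>))"
          by (rule suminf_finite) (auto simp: I_def)
        also have "\<dots> = (\<Sum>i<card (G n). ennreal (((1/2) ^ n) powr \<alpha>))"
          using True meas bij_betwE[OF e[of n]] by (intro sum.cong) (auto simp: I_def)
        also have "\<dots> = ennreal (real (card (G n)) * ((1/2) ^ n) powr \<alpha>)"
          by (simp add: ennreal_mult ennreal_of_nat_eq_real_of_nat)
        also have "\<dots> \<le> ennreal (2 powr (real n * d) * ((1/2) ^ n) powr \<alpha>)"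
          using card by (intro ennreal_leI mult_right_mono) auto
        also have "2 powr (real n * d) * ((1/2) ^ n) powr \<alpha> = x ^ n"
          unfolding x_def by (simp add: powr_def exp_diff ln_realpow ln_div exp_minus field_simps
            flip: exp_of_nat_mult exp_add)
        finally show ?thesis using True by simp
      qed (simp add: I_def)
    qed auto
    also have "\<dots> = ennreal (x ^ N / (1 - x))"
    proof -
      have "(\<lambda>n. x ^ n * x ^ N) sums (1 / (1 - x) * x ^ N)"
        using x by (intro sums_mult2 geometric_sums) auto
      then have "(\<lambda>n. if N \<le> n + N then x ^ (n + N) else 0) sums (x ^ N / (1 - x))"
        by (simp add: power_add)
      then have "(\<lambda>n. if N \<le> n then x ^ n else 0) sums (x ^ N / (1 - x) + (\<Sum>n<N. if N \<le> n then x ^ n else 0))"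
        by (simp only: sums_iff_shift[where f="\<lambda>n. if N \<le> n then x ^ n else 0"])
      then have "(\<lambda>n. if N \<le> n then x ^ n else 0) sums (x ^ N / (1 - x))" by simp
      then have "(\<lambda>n. ennreal (if N \<le> n then x ^ n else 0)) sums ennreal (x ^ N / (1 - x))"
        using x by (subst sums_ennreal) auto
      moreover have "(\<lambda>n. ennreal (if N \<le> n then x ^ n else 0)) = (\<lambda>n. if N \<le> n then ennreal (x ^ n) else 0)"
        by auto
      ultimately show ?thesis by (simp add: sums_iff)
    qed
    finally show ?thesis .
  qed
  have "((\<lambda>N. ennreal (x ^ N / (1 - x))) \<longlongrightarrow> ennreal (0 / (1 - x))) sequentially"
    using x by (intro tendsto_ennrealI tendsto_divide tendsto_const LIMSEQ_realpow_zero) auto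
  moreover have "eventually (\<lambda>N. (1/2) ^ N < \<epsilon>) sequentially"
    using \<epsilon> by (intro order_tendstoD(2)[OF LIMSEQ_realpow_zero]) auto
  then have "eventually (\<lambda>N. HB_premeasure \<nu> \<alpha> \<epsilon> E \<le> ennreal (x ^ N / (1 - x))) sequentially"
    by eventually_elim (auto intro: bound)
  ultimately have "HB_premeasure \<nu> \<alpha> \<epsilon> E \<le> ennreal (0 / (1 - x))"
    by (intro tendsto_lowerbound) auto
  then show "HB_premeasure \<nu> \<alpha> \<epsilon> E = 0" by simp
qed

text \<open>
  The limsup set of the selected cylinders has full measure as soon as the selections exhaust the
  measure along some sequence of ranks, since then already the cylinders of ranks from \<open>N\<close> on have
  full measure for every \<open>N\<close>.
\<close>
lemma HB_dim_measure_le: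
  assumes m: "product_law m w" and \<nu>: "product_law \<nu> (\<lambda>_ _. 1/2)" and d: "0 \<le> d"
    and G: "\<And>n. G n \<subseteq> Pow {..<n}" and card: "\<And>n. real (card (G n)) \<le> 2 powr (real n * d)"
    and full: "\<And>e N. e > 0 \<Longrightarrow> \<exists>n\<ge>N. (\<Sum>B\<in>G n. word_weight w n B) \<ge> 1 - e"
  shows "HB_dim_measure m \<nu> \<le> ereal d"
proof -
  interpret m: prob_space m using m unfolding product_law_def by blast
  have [simp]: "sets m = sets borel" using m unfolding product_law_def by blast
  have fin: "finite (G n)" for n using G by (rule finite_subset) simp
  define U where "U N = (\<Union>n\<in>{N..}. \<Union>B\<in>G n. cyl n B)" for N
  have U: "U N \<in> sets borel" for N
  proof -
    have "(\<Union>B\<in>G n. cyl n B) \<in> sets borel" for n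
      by (intro sets.finite_UN fin cyl_borel)
    then show ?thesis unfolding U_def by (intro sets.countable_UN') auto
  qed
  have "measure m (U N) = 1" for N
  proof (rule antisym)
    show "1 \<le> measure m (U N)"
    proof (rule field_le_epsilon)
      fix e :: real assume "e > 0"
      then obtain n where n: "n \<ge> N" "(\<Sum>B\<in>G n. word_weight w n B) \<ge> 1 - e" using full by blast
      have "1 - e \<le> measure m (\<Union>B\<in>G n. cyl n B)" using n measure_Union_cyl[OF m G] by simp
      also have "\<dots> \<le> measure m (U N)"
        using U n(1) by (intro m.finite_measure_mono) (auto simp: U_def)
      finally show "1 \<le> measure m (U N) + e" by simp
    qed
  qed simp
  then have "AE z in m. z \<in> U N" for N
    using U m.prob_eq_1[of "U N"] by simp
  then have "AE z in m. \<forall>N. z \<in> U N" by (simp add: AE_all_countable)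
  then have "AE z in m. z \<in> (\<Inter>N. U N)" by simp
  moreover have IU: "(\<Inter>N. U N) \<in> sets borel" using U by auto
  ultimately have "measure m (\<Inter>N. U N) = 1" by (subst m.prob_eq_1) auto
  moreover have "bounded (\<Inter>N. U N)"
  proof (rule bounded_subset)
    show "bounded (cyl 0 {})" unfolding cyl_def by simp
    show "(\<Inter>N. U N) \<subseteq> cyl 0 {}" using cyl_subset_cyl_0 unfolding U_def by blast
  qed
  ultimately have "HB_dim_measure m \<nu> \<le> HB_dim (\<Inter>N. U N) \<nu>"
    unfolding HB_dim_measure_def using IU by (intro INF_lower) auto
  also have "\<dots> \<le> ereal d"
    by (rule limsup_cyl_dim_le[OF \<nu> d G card]) (simp add: U_def)
  finally show ?thesis .
qed

end

section \<open>The law of the random series\<close>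

text \<open>
  Almost surely all digits are \<open>0\<close> or \<open>1\<close>. For such outcomes the disjointness of the cylinder
  intervals turns membership of the series in one of them into a condition on the first \<open>n\<close> digits.
\<close>
lemma (in dominating_series) product_law_distr:
  assumes M: "prob_space M" and X: "independent_digits M X p"
    and p_sum: "\<And>k. p 0 (Suc k) + p 1 (Suc k) = 1"
    and c: "\<And>k. c k = (-1) ^ k / real (q (Suc k))"
  shows "product_law (distr M borel (alt_series q X)) (\<lambda>k b. p (of_bool b) (Suc k))"
proof -
  interpret prob_space M by fact
  have indep: "indep_vars (\<lambda>_. borel) X {1..}"
    and p: "\<And>k i. k \<ge> 1 \<Longrightarrow> i \<in> {0,1} \<Longrightarrow> prob {\<omega>\<in>space M. X k \<omega> = real i} = p i k"
    using X unfolding independent_digits_def by auto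
  have rv [measurable]: "X (Suc k) \<in> borel_measurable M" for k
    using indep unfolding indep_vars_def2 by simp
  have meas [measurable]: "alt_series q X \<in> borel_measurable M"
    unfolding alt_series_def by measurable
  define A where "A \<omega> = {k. X (Suc k) \<omega> = 1}" for \<omega>
  have "AE \<omega> in M. X (Suc k) \<omega> \<in> {0, 1}" for k
  proof -
    have "prob ({\<omega>\<in>space M. X (Suc k) \<omega> = real 0} \<union> {\<omega>\<in>space M. X (Suc k) \<omega> = real 1})
        = p 0 (Suc k) + p 1 (Suc k)"
      using p[of "Suc k" 0] p[of "Suc k" 1] by (subst finite_measure_Union) auto
    then have "prob {\<omega>\<in>space M. X (Suc k) \<omega> \<in> {0, 1}} = 1"
      unfolding p_sum by (simp add: Collect_disj_eq conj_disj_distribL)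
    then have "AE \<omega> in M. \<omega> \<in> {\<omega>\<in>space M. X (Suc k) \<omega> \<in> {0, 1}}" by (rule AE_prob_1)
    then show ?thesis by (rule eventually_mono) simp
  qed
  then have digits: "AE \<omega> in M. \<forall>k. X (Suc k) \<omega> \<in> {0, 1}"
    by (subst AE_all_countable) blast
  have series: "alt_series q X \<omega> = subsum (A \<omega>)" if "\<forall>k. X (Suc k) \<omega> \<in> {0, 1}" for \<omega>
    unfolding alt_series_def subsum_def
  proof (rule suminf_cong)
    fix k
    show "(- 1) ^ k * X (Suc k) \<omega> / real (q (Suc k)) = c k * indicat_real (A \<omega>) k"
      using that[rule_format, of k] by (auto simp: c A_def)
  qed
  have law: "measure (distr M borel (alt_series q X)) (cyl n B)
      = word_weight (\<lambda>k b. p (of_bool b) (Suc k)) n B" if B: "B \<subseteq> {..<n}" for n B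
  proof -
    have "measure (distr M borel (alt_series q X)) (cyl n B)
        = prob {\<omega>\<in>space M. alt_series q X \<omega> \<in> cyl n B}"
      by (subst measure_distr) (auto simp: vimage_def Int_def conj_commute intro: cyl_borel)
    also have "\<dots> = prob {\<omega>\<in>space M. \<forall>k<n. X (Suc k) \<omega> = of_bool (k \<in> B)}"
    proof (rule measure_eq_AE)
      show "AE \<omega> in M. \<omega> \<in> {\<omega>\<in>space M. alt_series q X \<omega> \<in> cyl n B} \<longleftrightarrow>
          \<omega> \<in> {\<omega>\<in>space M. \<forall>k<n. X (Suc k) \<omega> = of_bool (k \<in> B)}"
        using digits
      proof (eventually_elim)
        fix \<omega> assume d: "\<forall>k. X (Suc k) \<omega> \<in> {0, 1}"
        have "alt_series q X \<omega> \<in> cyl n B \<longleftrightarrow> A \<omega> \<inter> {..<n} = B"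
          unfolding series[OF d] using subsum_in_cyl[of "A \<omega>" n] cyl_disjoint[OF _ B, of "A \<omega> \<inter> {..<n}"]
          by auto
        also have "\<dots> \<longleftrightarrow> (\<forall>k<n. X (Suc k) \<omega> = of_bool (k \<in> B))"
        proof
          assume "A \<omega> \<inter> {..<n} = B"
          then show "\<forall>k<n. X (Suc k) \<omega> = of_bool (k \<in> B)" using d by (auto simp: A_def)
        next
          assume *: "\<forall>k<n. X (Suc k) \<omega> = of_bool (k \<in> B)"
          show "A \<omega> \<inter> {..<n} = B"
          proof (intro set_eqI iffI)
            fix k assume "k \<in> A \<omega> \<inter> {..<n}"
            then show "k \<in> B" using *[rule_format, of k] by (cases "k \<in> B") (auto simp: A_def)
          next
            fix k assume "k \<in> B"
            then show "k \<in> A \<omega> \<inter> {..<n}" using B *[rule_format, of k] by (auto simp: A_def)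
          qed
        qed
        finally show "\<omega> \<in> {\<omega>\<in>space M. alt_series q X \<omega> \<in> cyl n B} \<longleftrightarrow>
          \<omega> \<in> {\<omega>\<in>space M. \<forall>k<n. X (Suc k) \<omega> = of_bool (k \<in> B)}" by simp
      qed
    qed measurable
    also have "\<dots> = (\<Prod>k<n. prob {\<omega>\<in>space M. X (Suc k) \<omega> = of_bool (k \<in> B)})"
    proof (cases "n = 0")
      case True
      then show ?thesis by (simp add: prob_space)
    next
      case False
      define S :: "nat \<Rightarrow> real set" where "S i = {of_bool (i - 1 \<in> B)}" for i
      have "{\<omega>\<in>space M. \<forall>k<n. X (Suc k) \<omega> = of_bool (k \<in> B)}
          = (\<Inter>i\<in>Suc ` {..<n}. X i -` S i \<inter> space M)"
        using False by (auto simp: S_def)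
      also have "prob \<dots> = (\<Prod>i\<in>Suc ` {..<n}. prob (X i -` S i \<inter> space M))"
        using False by (intro indep_varsD[OF indep]) (auto simp: S_def)
      also have "\<dots> = (\<Prod>k<n. prob {\<omega>\<in>space M. X (Suc k) \<omega> = of_bool (k \<in> B)})"
        unfolding prod.reindex[OF inj_Suc[THEN inj_on_subset, OF subset_UNIV]]
        by (intro prod.cong) (auto simp: S_def intro!: arg_cong[where f=prob])
      finally show ?thesis .
    qed
    also have "\<dots> = word_weight (\<lambda>k b. p (of_bool b) (Suc k)) n B"
      unfolding word_weight_def
    proof (rule prod.cong)
      fix k
      show "prob {\<omega>\<in>space M. X (Suc k) \<omega> = of_bool (k \<in> B)} = p (of_bool (k \<in> B)) (Suc k)"
        using p[of "Suc k" "of_bool (k \<in> B)"] by simp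
    qed simp
    finally show ?thesis .
  qed
  show ?thesis
    unfolding product_law_def using law prob_space_distr[OF meas] by simp
qed

section \<open>Entropy of binary digits\<close>

definition bin_entropy :: "real \<Rightarrow> real" where
  "bin_entropy x = - (x * ln x + (1 - x) * ln (1 - x))"

text \<open>
  With \<open>s = sqrt (2 z)\<close> the bound \<open>ln s \<ge> 1 - 1 / s\<close> gives
  \<open>z ln (2 z) \<ge> s\<^sup>2 - s = z - 1/2 + (s - 1)\<^sup>2 / 2\<close>. Summed over \<open>z = x\<close> and \<open>z = 1 - x\<close>, the
  linear parts cancel and squared differences of square roots remain: relative entropy dominates the
  Hellinger distance.
\<close>
lemma bin_entropy_deficit:
  assumes "0 < x" "x < 1"
  shows "(x - 1/2)\<^sup>2 / 4 \<le> ln 2 - bin_entropy x"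
proof -
  have half: "z - 1/2 + (z - 1/2)\<^sup>2 / 8 \<le> z * ln (2 * z)" if z: "0 < z" "z < 1" for z :: real
  proof -
    define s where "s = sqrt (2 * z)"
    have s: "s > 0" "s\<^sup>2 = 2 * z" "s \<le> 2"
      using z unfolding s_def by (auto intro: real_le_lsqrt)
    have "ln (1 / s) \<le> 1 / s - 1" using s by (intro ln_le_minus_one) auto
    then have "1 - 1 / s \<le> ln s" using s by (simp add: ln_div)
    then have "s\<^sup>2 * (1 - 1 / s) \<le> s\<^sup>2 * ln s" by (rule mult_left_mono) simp
    moreover have "s\<^sup>2 * (1 - 1 / s) = s\<^sup>2 - s"
      using s(1) by (simp add: power2_eq_square right_diff_distrib)
    moreover have "s\<^sup>2 * ln s = z * ln (2 * z)"
      using s z by (simp add: ln_sqrt s_def)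
    ultimately have "s\<^sup>2 - s \<le> z * ln (2 * z)" by simp
    moreover have "s\<^sup>2 - s = z - 1/2 + (s - 1)\<^sup>2 / 2"
      using s(2) by (simp add: power2_diff diff_divide_distrib add_divide_distrib)
    moreover have "(z - 1/2)\<^sup>2 / 8 \<le> (s - 1)\<^sup>2 / 2"
    proof -
      have "z - 1/2 = (s - 1) * (s + 1) / 2" using s(2) by (simp add: power2_eq_square algebra_simps)
      then have "(z - 1/2)\<^sup>2 = (s - 1)\<^sup>2 * ((s + 1)\<^sup>2 / 4)"
        by (simp only: power_mult_distrib power_divide) simp
      also have "\<dots> \<le> (s - 1)\<^sup>2 * 4"
        using power_mono[of "s + 1" 4 2] s by (intro mult_left_mono) auto
      finally show ?thesis by simp
    qed
    ultimately show ?thesis by linarith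
  qed
  have "ln 2 - bin_entropy x = x * ln (2 * x) + (1 - x) * ln (2 * (1 - x))"
  proof -
    have "ln (2 * x) = ln 2 + ln x" "ln (2 * (1 - x)) = ln 2 + ln (1 - x)"
      by (rule ln_mult_pos; use assms in simp)+
    then show ?thesis unfolding bin_entropy_def by (simp only:) (simp add: algebra_simps)
  qed
  moreover have "((1 - x) - 1/2)\<^sup>2 = (x - 1/2)\<^sup>2" by (simp add: power2_eq_square algebra_simps)
  ultimately show ?thesis using half[of x] half[of "1 - x"] assms by simp
qed

lemma bin_entropy_pos:
  assumes "0 < x" "x < 1"
  shows "0 < bin_entropy x"
proof -
  have "x * ln x < 0" "(1 - x) * ln (1 - x) < 0"
    using assms by (simp_all add: mult_pos_neg)
  then show ?thesis unfolding bin_entropy_def by linarith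
qed

lemma bin_entropy_le_neg_ln:
  assumes "0 < b" "b < x" "b < 1 - x"
  shows "bin_entropy x \<le> - ln b"
proof -
  have "x * - ln x \<le> x * - ln b" "(1 - x) * - ln (1 - x) \<le> (1 - x) * - ln b"
    using assms by (auto intro!: mult_left_mono)
  then have "bin_entropy x \<le> x * - ln b + (1 - x) * - ln b"
    unfolding bin_entropy_def by linarith
  then show ?thesis by (simp add: algebra_simps)
qed

lemma abs_ln_le:
  fixes b y :: real
  assumes "0 < b" "b \<le> 1" "b \<le> y"
  shows "\<bar>ln y\<bar> \<le> \<bar>y - 1\<bar> / b"
proof (cases "y \<ge> 1")
  case True
  have "ln y \<le> (y - 1) / 1" using ln_le_minus_one[of y] True by simp
  also have "\<dots> \<le> (y - 1) / b" using True assms by (intro divide_left_mono) auto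
  finally show ?thesis using True by simp
next
  case False
  then have "y > 0" "y < 1" using assms by auto
  have "- ln y \<le> (1 - y) / y"
    using ln_le_minus_one[of "1 / y"] \<open>y > 0\<close> by (simp add: ln_div diff_divide_distrib)
  also have "\<dots> \<le> (1 - y) / b" using assms \<open>y < 1\<close> by (intro divide_left_mono) auto
  finally show ?thesis using \<open>y < 1\<close> \<open>y > 0\<close> by simp
qed

definition digit_weight :: "(nat \<Rightarrow> real) \<Rightarrow> nat \<Rightarrow> bool \<Rightarrow> real" where
  "digit_weight x k b = (if b then x k else 1 - x k)"

lemma word_weight_eq_exp:
  assumes "\<And>k b. w k b > 0"
  shows "word_weight w n B = exp (\<Sum>k<n. ln (w k (k \<in> B)))"
  unfolding word_weight_def using assms by (simp add: exp_sum)

locale bounded_digits =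
  fixes x :: "nat \<Rightarrow> real" and b :: real
  assumes b_pos: "0 < b" and x_gt: "b < x k" and x_lt: "b < 1 - x k"
begin

lemma b_half: "b < 1/2"
  using x_gt[of 0] x_lt[of 0] by linarith

lemma x_bounds: "0 < x k" "x k < 1"
  using b_pos x_gt[of k] x_lt[of k] by linarith+

lemma digit_weight_gt: "b < digit_weight x k e"
  using x_gt x_lt by (simp add: digit_weight_def)

lemma digit_weight_pos: "0 < digit_weight x k e"
  using digit_weight_gt[of k e] b_pos by linarith

lemma digit_weight_total: "digit_weight x k False + digit_weight x k True = 1"
  by (simp add: digit_weight_def)

lemma sum_entropy_le: "(\<Sum>k<n. bin_entropy (x k)) \<le> real n * ln 2"
proof -
  have "bin_entropy (x k) \<le> ln 2" for k
    using bin_entropy_deficit[OF x_bounds, of k] zero_le_power2[of "x k - 1/2"] by linarith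
  then show ?thesis using sum_bounded_above[of "{..<n}" "\<lambda>k. bin_entropy (x k)" "ln 2"] by simp
qed

text \<open>
  Since the digit weights exceed \<open>b\<close>, \<open>\<bar>ln (2 w)\<bar>\<close> is at most \<open>\<bar>x\<^sub>k - 1/2\<bar> / b\<close>, and the entropy
  deficit bounds the square of the numerator. The inequality of arithmetic and geometric means with a
  parameter \<open>\<eta>\<close> trades the square root for a small multiple of \<open>n\<close>.
\<close>
lemma log_dyadic_digit_weight:
  assumes def: "\<And>\<delta>. \<delta> > 0 \<Longrightarrow> \<exists>N. \<forall>n\<ge>N. real n * ln 2 - (\<Sum>k<n. bin_entropy (x k)) \<le> \<delta> * real n"
  shows "log_dyadic (digit_weight x)"
  unfolding log_dyadic_def
proof (intro allI impI)
  fix \<tau> :: real assume "\<tau> > 0"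
  define \<eta> where "\<eta> = \<tau> * b / 2"
  have \<eta>: "\<eta> > 0" using \<open>\<tau> > 0\<close> b_pos by (simp add: \<eta>_def)
  obtain N where N: "\<And>n. n \<ge> N \<Longrightarrow> real n * ln 2 - (\<Sum>k<n. bin_entropy (x k)) \<le> \<eta>\<^sup>2 * real n"
    using def[of "\<eta>\<^sup>2"] \<eta> by auto
  have term_le: "\<bar>ln (2 * digit_weight x k e)\<bar> \<le> (\<eta> + (ln 2 - bin_entropy (x k)) / \<eta>) / b" for k e
  proof -
    let ?z = "\<bar>x k - 1/2\<bar>"
    have "\<bar>ln (2 * digit_weight x k e)\<bar> \<le> \<bar>2 * digit_weight x k e - 1\<bar> / (2 * b)"
      using b_pos b_half digit_weight_gt[of k e] by (intro abs_ln_le) auto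
    also have "\<bar>2 * digit_weight x k e - 1\<bar> = 2 * ?z"
      by (auto simp: digit_weight_def abs_if)
    also have "2 * ?z / (2 * b) = ?z / b" by simp
    also have "?z / b \<le> (\<eta> + (ln 2 - bin_entropy (x k)) / \<eta>) / b"
    proof (intro divide_right_mono)
      have "0 \<le> (?z / 2 - \<eta>)\<^sup>2" by simp
      also have "\<dots> = ?z\<^sup>2 / 4 - ?z * \<eta> + \<eta> * \<eta>"
        by (simp only: power2_diff power_divide) (simp add: power2_eq_square)
      finally have "?z * \<eta> \<le> \<eta> * \<eta> + ?z\<^sup>2 / 4" by simp
      also have "\<dots> \<le> \<eta> * \<eta> + (ln 2 - bin_entropy (x k))"
        using bin_entropy_deficit[OF x_bounds, of k] by simp
      finally have "?z \<le> (\<eta> * \<eta> + (ln 2 - bin_entropy (x k))) / \<eta>"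
        using \<eta> by (simp only: pos_le_divide_eq)
      also have "\<dots> = \<eta> + (ln 2 - bin_entropy (x k)) / \<eta>"
        using \<eta> by (simp only: add_divide_distrib) simp
      finally show "?z \<le> \<eta> + (ln 2 - bin_entropy (x k)) / \<eta>" .
    qed (use b_pos in simp)
    finally show ?thesis .
  qed
  show "\<exists>N. \<forall>n\<ge>N. \<forall>B\<subseteq>{..<n}. exp (- (real n * (ln 2 + \<tau>))) \<le> word_weight (digit_weight x) n B \<and>
      word_weight (digit_weight x) n B \<le> exp (- (real n * (ln 2 - \<tau>)))"
  proof (intro exI[of _ N] allI impI)
    fix n B assume "n \<ge> N"
    have "\<bar>\<Sum>k<n. ln (2 * digit_weight x k (k \<in> B))\<bar> \<le> (\<Sum>k<n. \<bar>ln (2 * digit_weight x k (k \<in> B))\<bar>)"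
      by (rule sum_abs)
    also have "\<dots> \<le> (\<Sum>k<n. (\<eta> + (ln 2 - bin_entropy (x k)) / \<eta>) / b)"
      by (intro sum_mono term_le)
    also have "\<dots> = (real n * \<eta> + (real n * ln 2 - (\<Sum>k<n. bin_entropy (x k))) / \<eta>) / b"
      by (simp add: sum.distrib sum_subtractf flip: sum_divide_distrib)
    also have "\<dots> \<le> (real n * \<eta> + \<eta>\<^sup>2 * real n / \<eta>) / b"
      using N[OF \<open>n \<ge> N\<close>] \<eta> b_pos by (intro divide_right_mono add_left_mono) auto
    also have "\<dots> = real n * \<tau>"
    proof -
      have "\<eta>\<^sup>2 * real n / \<eta> = real n * \<eta>" using \<eta> by (simp add: power2_eq_square)
      moreover have "(real n * \<eta> + real n * \<eta>) / b = real n * \<tau>" using b_pos by (simp add: \<eta>_def)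
      ultimately show ?thesis by simp
    qed
    finally have le: "\<bar>\<Sum>k<n. ln (2 * digit_weight x k (k \<in> B))\<bar> \<le> real n * \<tau>" .
    have "(\<Sum>k<n. ln (2 * digit_weight x k (k \<in> B))) = real n * ln 2 + (\<Sum>k<n. ln (digit_weight x k (k \<in> B)))"
      using digit_weight_pos by (simp add: ln_mult_pos sum.distrib)
    then show "exp (- (real n * (ln 2 + \<tau>))) \<le> word_weight (digit_weight x) n B \<and>
      word_weight (digit_weight x) n B \<le> exp (- (real n * (ln 2 - \<tau>)))"
      using le unfolding word_weight_eq_exp[of "digit_weight x", OF digit_weight_pos] by (simp add: algebra_simps abs_le_iff)
  qed
qed

text \<open>
  Chebyshev's inequality for the sum of the information contents \<open>- ln w\<close> of the digits, whose
  mean is the total entropy and whose deviations are bounded by \<open>- ln b\<close>.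
\<close>
lemma light_words_weight_le:
  assumes \<eta>: "0 < \<eta>" and "0 < n"
  shows "(\<Sum>B\<in>{B\<in>Pow {..<n}. word_weight (digit_weight x) n B <
      exp (- ((\<Sum>k<n. bin_entropy (x k)) + real n * \<eta>))}. word_weight (digit_weight x) n B)
    \<le> (ln b)\<^sup>2 / (real n * \<eta>\<^sup>2)"
proof -
  let ?w = "digit_weight x" and ?h = "\<lambda>k. bin_entropy (x k)"
  let ?W = "word_weight ?w n"
  define d where "d k e = - ln (?w k e) - ?h k" for k e
  define D where "D B = (\<Sum>k<n. d k (k \<in> B))" for B
  define L where "L = {B\<in>Pow {..<n}. ?W B < exp (- ((\<Sum>k<n. ?h k) + real n * \<eta>))}"
  have W_exp: "?W B = exp (\<Sum>k<n. ln (?w k (k \<in> B)))" for B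
    by (rule word_weight_eq_exp) (rule digit_weight_pos)
  have centred: "?w k False * d k False + ?w k True * d k True = 0" for k
    unfolding d_def digit_weight_def bin_entropy_def by (simp add: algebra_simps)
  have d_le: "(d k e)\<^sup>2 \<le> (ln b)\<^sup>2" for k e
  proof -
    have "?w k e < 1" using x_bounds[of k] by (simp add: digit_weight_def)
    then have "ln b \<le> ln (?w k e)" "ln (?w k e) \<le> 0"
      using b_pos digit_weight_gt[of k e] digit_weight_pos[of k e] by auto
    moreover have "0 \<le> ?h k" "?h k \<le> - ln b"
      using bin_entropy_pos[OF x_bounds, of k] bin_entropy_le_neg_ln[OF b_pos x_gt x_lt, of k] by auto
    ultimately have "\<bar>d k e\<bar> \<le> \<bar>ln b\<bar>" unfolding d_def by linarith
    then show ?thesis by (simp only: abs_le_square_iff)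
  qed
  have D_ge: "(real n * \<eta>)\<^sup>2 \<le> (D B)\<^sup>2" if "B \<in> L" for B
  proof -
    have "(\<Sum>k<n. ln (?w k (k \<in> B))) < - ((\<Sum>k<n. ?h k) + real n * \<eta>)"
      using that unfolding L_def W_exp by simp
    then have "real n * \<eta> \<le> D B"
      unfolding D_def d_def by (simp add: sum_subtractf sum_negf)
    then show ?thesis using \<eta> by (intro power_mono) auto
  qed
  have "(\<Sum>B\<in>L. ?W B) * (real n * \<eta>)\<^sup>2 = (\<Sum>B\<in>L. ?W B * (real n * \<eta>)\<^sup>2)"
    by (simp add: sum_distrib_right)
  also have "\<dots> \<le> (\<Sum>B\<in>L. ?W B * (D B)\<^sup>2)"
    using D_ge by (intro sum_mono mult_left_mono) (auto simp: W_exp)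
  also have "\<dots> \<le> (\<Sum>B\<in>Pow {..<n}. ?W B * (D B)\<^sup>2)"
    by (intro sum_mono2) (auto simp: L_def W_exp)
  also have "\<dots> = (\<Sum>k<n. ?w k False * (d k False)\<^sup>2 + ?w k True * (d k True)\<^sup>2)"
    unfolding D_def by (rule sum_word_weight_second_moment(2)[OF digit_weight_total centred])
  also have "\<dots> \<le> (\<Sum>k<n. ?w k False * (ln b)\<^sup>2 + ?w k True * (ln b)\<^sup>2)"
    using d_le digit_weight_pos by (intro sum_mono add_mono mult_left_mono) (auto intro: less_imp_le)
  also have "\<dots> = real n * (ln b)\<^sup>2"
    by (simp add: digit_weight_total flip: distrib_right)
  finally have "(\<Sum>B\<in>L. ?W B) \<le> real n * (ln b)\<^sup>2 / (real n * \<eta>)\<^sup>2"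
    using \<eta> \<open>0 < n\<close> by (simp add: pos_le_divide_eq)
  also have "\<dots> = (ln b)\<^sup>2 / (real n * \<eta>\<^sup>2)"
    using \<open>0 < n\<close> by (simp add: power2_eq_square)
  finally show ?thesis by (simp add: L_def)
qed

end

lemma log_dyadic_half: "log_dyadic (\<lambda>_ _. 1/2)"
proof -
  have "exp (- (real n * (ln 2 + \<tau>))) \<le> (1/2) ^ n \<and> (1/2) ^ n \<le> exp (- (real n * (ln 2 - \<tau>)))"
    if "\<tau> > 0" for \<tau> :: real and n
  proof -
    have "(1/2::real) ^ n = exp (- ln 2) ^ n" by (simp add: exp_minus)
    then have "(1/2::real) ^ n = exp (- (real n * ln 2))"
      by (simp only: exp_of_nat_mult[symmetric] mult_minus_right)
    then show ?thesis using that by (simp add: mult_left_mono)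
  qed
  then show ?thesis unfolding log_dyadic_def word_weight_def by simp
qed

section \<open>Entropy and the dimension of the law\<close>

context dominating_series
begin

lemma HB_dim_measure_le_1:
  assumes m: "product_law m w" and \<nu>: "product_law \<nu> (\<lambda>_ _. 1/2)"
    and total: "\<And>k. w k False + w k True = 1"
  shows "HB_dim_measure m \<nu> \<le> 1"
proof -
  have "HB_dim_measure m \<nu> \<le> ereal 1"
  proof (rule HB_dim_measure_le[OF m \<nu>, where G="\<lambda>n. Pow {..<n}"])
    show "real (card (Pow {..<n})) \<le> 2 powr (real n * 1)" for n
      by (simp add: card_Pow powr_realpow)
    show "\<exists>n\<ge>N. (\<Sum>B\<in>Pow {..<n}. word_weight w n B) \<ge> 1 - e" if "e > 0" for e :: real and N
      using that by (auto simp: sum_word_weight[of w, OF total])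
  qed auto
  then show ?thesis by (simp add: one_ereal_def)
qed

text \<open>
  Words of weight at least \<open>2 ^ (- n d)\<close> number at most \<open>2 ^ (n d)\<close>. At the ranks of low entropy
  \<open>light_words_weight_le\<close>, with a margin \<open>(d - r) ln 2\<close> per digit, shows that the remaining words
  are negligible.
\<close>
lemma HB_dim_measure_le_entropy:
  assumes bd: "bounded_digits x b"
    and m: "product_law m (digit_weight x)" and \<nu>: "product_law \<nu> (\<lambda>_ _. 1/2)"
    and d: "0 \<le> d" "r < d"
    and freq: "\<And>N. \<exists>n\<ge>N. (\<Sum>k<n. bin_entropy (x k)) \<le> real n * r * ln 2"
  shows "HB_dim_measure m \<nu> \<le> ereal d"
proof -
  interpret bounded_digits x b by fact
  let ?W = "word_weight (digit_weight x)"
  define H where "H n = (\<Sum>k<n. bin_entropy (x k))" for n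
  define G where "G n = {B\<in>Pow {..<n}. 2 powr (- (real n * d)) \<le> ?W n B}" for n
  have W_nonneg: "0 \<le> ?W n B" for n B
    unfolding word_weight_def by (intro prod_nonneg ballI less_imp_le digit_weight_pos)
  have W_total: "(\<Sum>B\<in>Pow {..<n}. ?W n B) = 1" for n
    by (rule sum_word_weight) (rule digit_weight_total)
  show ?thesis
  proof (rule HB_dim_measure_le[OF m \<nu> d(1), where G=G])
    fix n
    show "G n \<subseteq> Pow {..<n}" unfolding G_def by blast
    have "real (card (G n)) * 2 powr (- (real n * d)) = (\<Sum>B\<in>G n. 2 powr (- (real n * d)))"
      by simp
    also have "\<dots> \<le> (\<Sum>B\<in>G n. ?W n B)" by (intro sum_mono) (simp add: G_def)
    also have "\<dots> \<le> (\<Sum>B\<in>Pow {..<n}. ?W n B)"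
      by (intro sum_mono2 W_nonneg) (auto simp: G_def)
    also have "\<dots> = 1" by (rule W_total)
    finally show "real (card (G n)) \<le> 2 powr (real n * d)"
      by (simp add: powr_minus field_simps)
  next
    fix e :: real and N assume "e > 0"
    define \<eta> where "\<eta> = (d - r) * ln 2"
    have \<eta>: "\<eta> > 0" using d by (simp add: \<eta>_def)
    obtain K where K: "(ln b)\<^sup>2 / (\<eta>\<^sup>2 * e) \<le> real K" using real_arch_simple by blast
    obtain n where n: "n \<ge> N + K + 1" and H: "H n \<le> real n * r * ln 2"
      using freq unfolding H_def by blast
    define L where "L = {B\<in>Pow {..<n}. ?W n B < exp (- (H n + real n * \<eta>))}"
    have "(\<Sum>B\<in>L. ?W n B) \<le> (ln b)\<^sup>2 / (real n * \<eta>\<^sup>2)"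
      unfolding L_def H_def using n \<eta> by (intro light_words_weight_le) auto
    also have "\<dots> \<le> e"
    proof -
      have "(ln b)\<^sup>2 / (\<eta>\<^sup>2 * e) \<le> real n" using K n by linarith
      then have "(ln b)\<^sup>2 \<le> real n * (\<eta>\<^sup>2 * e)" using \<eta> \<open>e > 0\<close> by (simp only: pos_divide_le_eq zero_less_power mult_pos_pos)
      then show ?thesis using \<eta> n by (subst pos_divide_le_eq) (auto simp: mult_ac)
    qed
    finally have light: "(\<Sum>B\<in>L. ?W n B) \<le> e" .
    have "2 powr (- (real n * d)) \<le> exp (- (H n + real n * \<eta>))"
      using H by (simp add: powr_def \<eta>_def algebra_simps)
    then have sub: "Pow {..<n} - L \<subseteq> G n" unfolding L_def G_def by auto
    have "1 - e \<le> (\<Sum>B\<in>Pow {..<n}. ?W n B) - (\<Sum>B\<in>L. ?W n B)" using light W_total[of n] by simp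
    also have "\<dots> = (\<Sum>B\<in>Pow {..<n} - L. ?W n B)"
      by (rule sum_diff[symmetric]) (auto simp: L_def)
    also have "\<dots> \<le> (\<Sum>B\<in>G n. ?W n B)"
      by (intro sum_mono2 sub W_nonneg) (simp add: G_def)
    finally have "(\<Sum>B\<in>G n. ?W n B) \<ge> 1 - e" .
    then show "\<exists>n\<ge>N. (\<Sum>B\<in>G n. ?W n B) \<ge> 1 - e"
      using n by (intro exI[of _ n]) simp
  qed
qed

end

section \<open>Preservation of dimension\<close>

theorem theorem9:
  fixes q :: "nat \<Rightarrow> nat" and p :: "nat \<Rightarrow> nat \<Rightarrow> real"
    and M :: "'a measure" and X :: "nat \<Rightarrow> 'a \<Rightarrow> real"
    and N :: "'b measure" and Y :: "nat \<Rightarrow> 'b \<Rightarrow> real"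
    and \<mu> \<nu> :: "real measure"
  assumes q_pos: "\<forall>k\<ge>1. q k > 0"
    and q_growth: "\<forall>k\<ge>1. q (Suc k) \<ge> q k * (q k + 1)"
    and p_sum: "\<forall>k\<ge>1. p 0 k + p 1 k = 1"
    and M: "prob_space M" and X: "independent_digits M X p"
    and N: "prob_space N" and Y: "independent_digits N Y (p_star p)"
    and mu: "\<mu> = distr M borel (alt_series q X)"
    and nu: "\<nu> = distr N borel (alt_series q Y)"
    and p_bound: "\<exists>p\<^sub>0>0. \<forall>i\<in>{0,1}. \<forall>k\<ge>1. p i k > p\<^sub>0"
  shows "((\<forall>E\<subseteq>spectrum \<mu>. HB_dim E \<mu> = HB_dim E \<nu>) \<longleftrightarrow> HB_dim_measure \<mu> \<nu> = 1) \<and>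
    (HB_dim_measure \<mu> \<nu> = 1 \<longleftrightarrow>
      liminf (\<lambda>n. ereal (total_entropy p n / (real (num_positive_entropy p n) * ln 2))) = 1)"
proof -
  define x where "x k = p 1 (Suc k)" for k
  obtain b where b: "b > 0" "\<And>i k. i \<in> {0,1} \<Longrightarrow> k \<ge> 1 \<Longrightarrow> p i k > b"
    using p_bound by blast
  have p0: "p 0 (Suc k) = 1 - x k" for k
    using p_sum[rule_format, of "Suc k"] unfolding x_def by simp
  have p1: "p (Suc 0) (Suc k) = x k" for k unfolding x_def by simp
  have bd: "bounded_digits x b"
  proof
    show "b > 0" by (rule b)
    show "b < x k" "b < 1 - x k" for k
      using b(2)[of 1 "Suc k"] b(2)[of 0 "Suc k"] p0[of k] unfolding x_def by simp_all
  qed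
  then interpret bounded_digits x b .
  interpret dominating_series "\<lambda>k. (-1) ^ k / real (q (Suc k))"
    by (rule dominating_series_alternating[OF q_pos q_growth])
  have "(\<lambda>k e. p (of_bool e) (Suc k)) = digit_weight x"
    by (intro ext) (simp add: digit_weight_def p0 p1)
  then have law_mu: "product_law \<mu> (digit_weight x)"
    using product_law_distr[OF M X, of q] p_sum unfolding mu by simp
  have star: "p_star p (of_bool e) (Suc k) = 1/2" for k e
    using x_bounds[of k] by (cases e) (simp_all add: p_star_def p0 p1)
  have star_sum: "p_star p 0 (Suc k) + p_star p 1 (Suc k) = 1" for k
    using star[of False k] star[of True k] by (simp only: of_bool_eq)
  have "(\<lambda>k e. p_star p (of_bool e) (Suc k)) = (\<lambda>_ _. 1/2)"
    by (intro ext) (rule star)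
  then have law_nu: "product_law \<nu> (\<lambda>_ _. 1/2)"
    using product_law_distr[OF N Y star_sum refl] unfolding nu by (simp only:)
  have prob_mu: "prob_space \<mu>" and sets_mu: "sets \<mu> = sets borel"
    using law_mu unfolding product_law_def by auto
  interpret mu: prob_space \<mu> by (rule prob_mu)
  define H where "H n = (\<Sum>k<n. bin_entropy (x k))" for n
  have entropy: "digit_entropy p (Suc k) = bin_entropy (x k)" for k
    unfolding digit_entropy_def bin_entropy_def by (simp add: p0 p1)
  have total: "total_entropy p n = H n" for n
    unfolding total_entropy_def H_def entropy[symmetric]
    by (rule sum.reindex_bij_witness[of _ Suc "\<lambda>k. k - 1"]) auto
  have "digit_entropy p k > 0" if "k \<ge> 1" for k
    using entropy[of "k - 1"] bin_entropy_pos[OF x_bounds, of "k - 1"] that by simp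
  then have "{k \<in> {1..n}. digit_entropy p k > 0} = {1..n}" for n by auto
  then have num: "num_positive_entropy p n = n" for n
    unfolding num_positive_entropy_def by simp
  define R where "R n = H n / (real n * ln 2)" for n
  have R_eq: "(\<lambda>n. ereal (total_entropy p n / (real (num_positive_entropy p n) * ln 2))) = (\<lambda>n. ereal (R n))"
    by (simp add: total num R_def)
  have R_le: "R n \<le> 1" for n
    using sum_entropy_le[of n] unfolding R_def H_def by (auto simp: divide_le_eq_1 zero_less_mult_iff)
  have R_nonneg: "0 \<le> R n" for n
    unfolding R_def H_def
    by (intro divide_nonneg_nonneg sum_nonneg mult_nonneg_nonneg less_imp_le[OF bin_entropy_pos] x_bounds) simp_all
  have preserve: "HB_dim E \<mu> = HB_dim E \<nu>" if lim: "liminf (\<lambda>n. ereal (R n)) = 1" for E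
  proof -
    have "log_dyadic (digit_weight x)"
    proof (rule log_dyadic_digit_weight)
      fix \<delta> :: real assume \<delta>: "\<delta> > 0"
      have "ereal (1 - \<delta> / ln 2) < liminf (\<lambda>n. ereal (R n))" using \<delta> lim by simp
      then have "eventually (\<lambda>n. 1 - \<delta> / ln 2 < R n) sequentially"
        by (auto dest: less_LiminfD)
      then obtain K where K: "\<And>n. n \<ge> K \<Longrightarrow> 1 - \<delta> / ln 2 < R n"
        unfolding eventually_sequentially by blast
      have "real n * ln 2 - H n \<le> \<delta> * real n" if "n \<ge> K" for n
      proof (cases "n = 0")
        case False
        then have "(1 - \<delta> / ln 2) * (real n * ln 2) \<le> H n"
          using K[OF that] unfolding R_def by (simp add: pos_less_divide_eq)
        then show ?thesis by (simp add: left_diff_distrib)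
      qed (simp add: H_def)
      then show "\<exists>N. \<forall>n\<ge>N. real n * ln 2 - (\<Sum>k<n. bin_entropy (x k)) \<le> \<delta> * real n"
        unfolding H_def by blast
    qed
    then show ?thesis
      using HB_dim_le_of_log_dyadic[OF law_mu law_nu _ _ log_dyadic_half, of E]
        HB_dim_le_of_log_dyadic[OF law_nu law_mu digit_weight_total log_dyadic_half, of E]
      by (intro antisym) simp_all
  qed
  have dim_1: "HB_dim_measure \<mu> \<nu> = 1"
    if pres: "\<forall>E\<subseteq>spectrum \<mu>. HB_dim E \<mu> = HB_dim E \<nu>"
  proof (rule antisym)
    show "HB_dim_measure \<mu> \<nu> \<le> 1"
      by (rule HB_dim_measure_le_1[OF law_mu law_nu digit_weight_total])
    show "1 \<le> HB_dim_measure \<mu> \<nu>"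
      unfolding HB_dim_measure_def
    proof (rule INF_greatest, clarify)
      fix E :: "real set" assume E: "E \<in> sets borel" "measure \<mu> E = 1"
      let ?S = "spectrum \<mu>"
      have S: "?S \<in> sets borel" by (intro borel_closed closed_spectrum)
      have "AE z in \<mu>. z \<in> E" using E by (intro mu.AE_prob_1)
      moreover have "AE z in \<mu>. z \<in> ?S"
        using emeasure_compl_spectrum[OF sets_mu] S
        by (intro AE_I[of _ _ "- ?S"]) (auto simp: sets_mu)
      ultimately have "AE z in \<mu>. z \<in> E \<inter> ?S" by auto
      then have "measure \<mu> (E \<inter> ?S) = 1"
        using E S by (subst mu.prob_eq_1) (auto simp: sets_mu)
      then have "1 \<le> HB_dim (E \<inter> ?S) \<mu>"
        using E S by (intro HB_dim_ge_1 prob_mu sets_mu) auto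
      also have "\<dots> = HB_dim (E \<inter> ?S) \<nu>" using pres by simp
      also have "\<dots> \<le> HB_dim E \<nu>" by (rule HB_dim_mono) simp
      finally show "1 \<le> HB_dim E \<nu>" .
    qed
  qed
  have liminf_1: "liminf (\<lambda>n. ereal (R n)) = 1" if dim: "HB_dim_measure \<mu> \<nu> = 1"
  proof (rule ccontr)
    assume ne: "liminf (\<lambda>n. ereal (R n)) \<noteq> 1"
    have "liminf (\<lambda>n. ereal (R n)) \<le> liminf (\<lambda>n. 1)"
      using R_le by (intro Liminf_mono) (simp add: one_ereal_def)
    with ne have "liminf (\<lambda>n. ereal (R n)) < ereal 1"
      by (simp add: Liminf_const one_ereal_def)
    then obtain r where r: "liminf (\<lambda>n. ereal (R n)) < ereal r" "r < 1"
      by (metis ereal_dense2 ereal_less_eq(3) less_ereal.simps(1))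
    have freq: "\<exists>n\<ge>K. n > 0 \<and> R n \<le> r" for K
    proof (rule ccontr)
      assume neg: "\<not> (\<exists>n\<ge>K. n > 0 \<and> R n \<le> r)"
      have "ereal r \<le> ereal (R n)" if n: "n \<ge> Suc K" for n
      proof -
        have "K \<le> n" "n > 0" using n by simp_all
        then have "\<not> R n \<le> r" using neg by blast
        then show ?thesis by simp
      qed
      then have "ereal r \<le> liminf (\<lambda>n. ereal (R n))"
        by (intro Liminf_bounded) (auto simp: eventually_sequentially)
      with r(1) show False by simp
    qed
    obtain n where "R n \<le> r" using freq by blast
    then have "0 \<le> r" using R_nonneg[of n] by linarith
    have "HB_dim_measure \<mu> \<nu> \<le> ereal ((1 + r) / 2)"
    proof (rule HB_dim_measure_le_entropy[OF bd law_mu law_nu])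
      show "0 \<le> (1 + r) / 2" "r < (1 + r) / 2" using r \<open>0 \<le> r\<close> by simp_all
      fix K
      obtain n where n: "n \<ge> K" "n > 0" "R n \<le> r" using freq by blast
      then have "H n \<le> r * (real n * ln 2)"
        unfolding R_def by (simp add: pos_divide_le_eq)
      then show "\<exists>n\<ge>K. (\<Sum>k<n. bin_entropy (x k)) \<le> real n * r * ln 2"
        using n(1) unfolding H_def by (auto simp: mult_ac)
    qed
    then show False using dim r(2) by (simp add: one_ereal_def)
  qed
  show ?thesis
    unfolding R_eq using preserve dim_1 liminf_1 by blast
qed

end
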